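(* Let $\alpha_1,\alpha_2,\alpha_3\in\mathbb{C}$ with $2\alpha_1+2\alpha_2+\alpha_3=1$. Consider a Hamiltonian system $$\frac{dx}{dt}=\frac{\partial H}{\partial y},\quad \frac{dy}{dt}=-\frac{\partial H}{\partial x},\quad \frac{dz}{dt}=\frac{\partial H}{\partial w},\quad \frac{dw}{dt}=-\frac{\partial H}{\partial z}$$ with polynomial Hamiltonian $H\in\mathbb{C}(t)[x,y,z,w]$. Assume: (A1) $\deg(H)\le 5$ with respect to $x,y,z,w$. (A2) The system becomes again a polynomial Hamiltonian system in each of the coordinate systems $(x_i,y_i,z_i,w_i)$, $i=1,2,3$: $$x_1=\frac1x,\quad y_1=-x(xy+\alpha_2),\quad z_1=z,\quad w_1=w;$$ $$x_2=x,\quad y_2=y,\quad z_2=\frac1z,\quad w_2=-(zw+\alpha_3)z;$$ $$x_3=\frac1x,\quad y_3=-\big((y-x^2-w-t)x-(x+z)w+\alpha_1\big)x,\quad z_3=-\frac wx,\quad w_3=x(x+z).$$ Then the system coincides with the system $$\frac{dx}{dt}=-2x^2+4y-3w-2t,\quad \frac{dy}{dt}=4xy+2\alpha_2,\quad \frac{dz}{dt}=z^2+2w-3y+t,\quad \frac{dw}{dt}=-2zw-\alpha_3,$$ that is, the Hamiltonian system with polynomial Hamiltonian $$-2x^2y+2y^2-2ty-2\alpha_2x+z^2w+w^2+tw+\alpha_3z-3yw .$$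
   Context: All variables are complex. "Becomes again a polynomial Hamiltonian system in the coordinates $(x_i,y_i,z_i,w_i)$" means that, after rewriting the system in these coordinates (taking the explicit $t$-dependence of the change of coordinates into account), it has the form $\frac{dx_i}{dt}=\frac{\partial H_i}{\partial y_i}$, $\frac{dy_i}{dt}=-\frac{\partial H_i}{\partial x_i}$, $\frac{dz_i}{dt}=\frac{\partial H_i}{\partial w_i}$, $\frac{dw_i}{dt}=-\frac{\partial H_i}{\partial z_i}$ for some $H_i\in\mathbb{C}(t)[x_i,y_i,z_i,w_i]$. A Hamiltonian is determined by its system only up to adding a function of $t$. *)

theory Defs
  imports Complex_Main "HOL-Computational_Algebra.Polynomial_Factorial"
begin

text \<open>
  The polynomial ring \<open>C(t)[x,y,z,w]\<close> is the iterated polynomial ring \<open>C(t)[x][y][z][w]\<close>: the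
  outermost \<open>poly\<close> is the one in \<open>w\<close>, the innermost the one in \<open>x\<close>.
\<close>

type_synonym ct = "complex poly fract"
type_synonym ct_xyzw = "ct poly poly poly poly"
type_synonym ct_xyzw_frac = "ct_xyzw fract"

definition scalar :: "ct \<Rightarrow> ct_xyzw" where
  "scalar c = [:[:[:[:c:]:]:]:]"

definition const :: "complex \<Rightarrow> ct_xyzw" where
  "const a = scalar (to_fract [:a:])"

definition T :: ct_xyzw where "T = scalar (to_fract [:0, 1:])"
definition X :: ct_xyzw where "X = [:[:[:[:0, 1:]:]:]:]"
definition Y :: ct_xyzw where "Y = [:[:[:0, 1:]:]:]"
definition Z :: ct_xyzw where "Z = [:[:0, 1:]:]"
definition W :: ct_xyzw where "W = [:0, 1:]"

definition total_degree_le :: "ct_xyzw \<Rightarrow> nat \<Rightarrow> bool" where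
  "total_degree_le p n \<longleftrightarrow>
    (\<forall>i j k l. coeff (coeff (coeff (coeff p l) k) j) i \<noteq> 0 \<longrightarrow> i + j + k + l \<le> n)"

text \<open>
  The extension of a derivation \<open>d\<close> of an integral domain to its fraction field by the quotient
  rule.  The description is meaningful only for derivations; see \<open>fract_deriv_Fract\<close>.
\<close>

definition derivation :: "('a::comm_ring_1 \<Rightarrow> 'a) \<Rightarrow> bool" where
  "derivation d \<longleftrightarrow>
    (\<forall>a b. d (a + b) = d a + d b) \<and> (\<forall>a b. d (a * b) = d a * b + a * d b)"

definition fract_deriv :: "('a::idom \<Rightarrow> 'a) \<Rightarrow> 'a fract \<Rightarrow> 'a fract" where
  "fract_deriv d q =
    (THE r. \<forall>a b. b \<noteq> 0 \<longrightarrow> q = Fract a b \<longrightarrow> r = Fract (d a * b - a * d b) (b * b))"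

lemma fract_deriv_Fract:
  fixes d :: "'a::idom \<Rightarrow> 'a"
  assumes "derivation d" "b \<noteq> 0"
  shows "fract_deriv d (Fract a b) = Fract (d a * b - a * d b) (b * b)"
proof -
  have *: "Fract (d a * b - a * d b) (b * b) = Fract (d a' * b' - a' * d b') (b' * b')"
    if b': "b' \<noteq> 0" and eq: "Fract a b = Fract a' b'" for a' b'
  proof -
    have e: "a * b' = a' * b"
      using eq b' assms(2) by (simp add: eq_fract)
    then have "d (a * b') = d (a' * b)" by simp
    then have de: "d a * b' + a * d b' = d a' * b + a' * d b"
      using assms(1) by (simp add: derivation_def)
    have "(d a * b - a * d b) * (b' * b') - (d a' * b' - a' * d b') * (b * b)
        = b * b' * ((d a * b' + a * d b') - (d a' * b + a' * d b))
          - (a * b' - a' * b) * (d b * b' + b * d b')"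
      by (simp add: algebra_simps)
    also have "\<dots> = 0" using e de by simp
    finally show ?thesis
      using b' assms(2) by (simp add: eq_fract)
  qed
  show ?thesis
    unfolding fract_deriv_def
  proof (rule the_equality)
    show "\<forall>a' b'. b' \<noteq> 0 \<longrightarrow> Fract a b = Fract a' b' \<longrightarrow>
        Fract (d a * b - a * d b) (b * b) = Fract (d a' * b' - a' * d b') (b' * b')"
      using * by blast
  next
    fix r
    assume "\<forall>a' b'. b' \<noteq> 0 \<longrightarrow> Fract a b = Fract a' b' \<longrightarrow>
        r = Fract (d a' * b' - a' * d b') (b' * b')"
    then show "r = Fract (d a * b - a * d b) (b * b)"
      using assms(2) by blast
  qed
qed

definition pd_w :: "ct_xyzw \<Rightarrow> ct_xyzw" where "pd_w = pderiv"
definition pd_z :: "ct_xyzw \<Rightarrow> ct_xyzw" where "pd_z = map_poly pderiv"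
definition pd_y :: "ct_xyzw \<Rightarrow> ct_xyzw" where "pd_y = map_poly (map_poly pderiv)"
definition pd_x :: "ct_xyzw \<Rightarrow> ct_xyzw" where "pd_x = map_poly (map_poly (map_poly pderiv))"
definition pd_t :: "ct_xyzw \<Rightarrow> ct_xyzw" where
  "pd_t = map_poly (map_poly (map_poly (map_poly (fract_deriv pderiv))))"

lemma derivation_pderiv: "derivation (pderiv :: 'a::idom poly \<Rightarrow> 'a poly)"
  by (simp add: derivation_def pderiv_add pderiv_mult mult.commute)

lemma derivation_0: "derivation d \<Longrightarrow> d 0 = 0"
  unfolding derivation_def by (metis add_cancel_right_left add_0)

lemma derivation_sum:
  assumes "derivation d"
  shows "d (\<Sum>i\<in>A. f i) = (\<Sum>i\<in>A. d (f i))"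
  using assms by (induction A rule: infinite_finite_induct)
    (auto simp: derivation_0[OF assms] derivation_def)

lemma derivation_map_poly:
  assumes "derivation d"
  shows "derivation (map_poly d)"
  using assms derivation_0[OF assms]
  by (auto simp: derivation_def poly_eq_iff coeff_map_poly coeff_mult
      derivation_sum[OF assms] sum.distrib)

lemma derivation_fract_deriv:
  assumes "derivation (d :: 'a::idom \<Rightarrow> 'a)"
  shows "derivation (fract_deriv d)"
proof -
  have "fract_deriv d (p + q) = fract_deriv d p + fract_deriv d q" for p q
    using assms
    by (cases p; cases q)
      (simp add: fract_deriv_Fract eq_fract, simp add: derivation_def algebra_simps)
  moreover have "fract_deriv d (p * q) = fract_deriv d p * q + p * fract_deriv d q" for p q
    using assms
    by (cases p; cases q)
      (simp add: fract_deriv_Fract eq_fract, simp add: derivation_def algebra_simps)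
  ultimately show ?thesis by (simp add: derivation_def)
qed

lemma derivation_pd:
  "derivation pd_x" "derivation pd_y" "derivation pd_z" "derivation pd_w" "derivation pd_t"
  unfolding pd_x_def pd_y_def pd_z_def pd_w_def pd_t_def
  by (intro derivation_map_poly derivation_fract_deriv derivation_pderiv)+

text \<open>A system \<open>(dx/dt, dy/dt, dz/dt, dw/dt)\<close> is given by its four right-hand sides.\<close>

type_synonym system = "ct_xyzw \<times> ct_xyzw \<times> ct_xyzw \<times> ct_xyzw"

definition hamiltonian_system :: "ct_xyzw \<Rightarrow> system" where
  "hamiltonian_system H = (pd_y H, - pd_x H, pd_w H, - pd_z H)"

text \<open>The derivative \<open>df/dt\<close> of a rational function \<open>f\<close> of \<open>t, x, y, z, w\<close> along a system.\<close>

definition time_deriv :: "system \<Rightarrow> ct_xyzw_frac \<Rightarrow> ct_xyzw_frac" where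
  "time_deriv = (\<lambda>(vx, vy, vz, vw) f.
     fract_deriv pd_t f
     + to_fract vx * fract_deriv pd_x f + to_fract vy * fract_deriv pd_y f
     + to_fract vz * fract_deriv pd_z f + to_fract vw * fract_deriv pd_w f)"

type_synonym coords = "ct_xyzw_frac \<times> ct_xyzw_frac \<times> ct_xyzw_frac \<times> ct_xyzw_frac"

text \<open>Substitution of rational functions for the four variables of a polynomial.\<close>

definition subst :: "coords \<Rightarrow> ct_xyzw \<Rightarrow> ct_xyzw_frac" where
  "subst = (\<lambda>(a, b, c, d) p.
     poly (map_poly (\<lambda>p3. poly (map_poly (\<lambda>p2. poly (map_poly (\<lambda>p1.
       poly (map_poly (\<lambda>r. to_fract (scalar r)) p1) a) p2) b) p3) c) p) d)"

text \<open>
  The coordinates are given as rational functions of \<open>t\<close> and the original coordinates, and the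
  transformed equations are compared in the original coordinates: \<open>dx\<^sub>i/dt\<close> equals the polynomial
  \<open>\<partial>G/\<partial>y\<^sub>i\<close> of the new coordinates, and so on.  The variables of \<open>G\<close> stand for the new coordinates.
\<close>

definition becomes_polynomial_hamiltonian :: "system \<Rightarrow> coords \<Rightarrow> bool" where
  "becomes_polynomial_hamiltonian v = (\<lambda>(xi, yi, zi, wi).
     \<exists>G. time_deriv v xi = subst (xi, yi, zi, wi) (pd_y G)
       \<and> time_deriv v yi = - subst (xi, yi, zi, wi) (pd_x G)
       \<and> time_deriv v zi = subst (xi, yi, zi, wi) (pd_w G)
       \<and> time_deriv v wi = - subst (xi, yi, zi, wi) (pd_z G))"

definition coords1 :: "complex \<Rightarrow> coords" where
  "coords1 \<alpha>\<^sub>2 =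
    (let x = to_fract X; y = to_fract Y; z = to_fract Z; w = to_fract W; a2 = to_fract (const \<alpha>\<^sub>2)
     in (1 / x, - x * (x * y + a2), z, w))"

definition coords2 :: "complex \<Rightarrow> coords" where
  "coords2 \<alpha>\<^sub>3 =
    (let x = to_fract X; y = to_fract Y; z = to_fract Z; w = to_fract W; a3 = to_fract (const \<alpha>\<^sub>3)
     in (x, y, 1 / z, - (z * w + a3) * z))"

definition coords3 :: "complex \<Rightarrow> coords" where
  "coords3 \<alpha>\<^sub>1 =
    (let x = to_fract X; y = to_fract Y; z = to_fract Z; w = to_fract W; t = to_fract T;
         a1 = to_fract (const \<alpha>\<^sub>1)
     in (1 / x, - ((y - x^2 - w - t) * x - (x + z) * w + a1) * x, - (w / x), x * (x + z)))"

end

theory Submission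
  imports Defs
begin

text \<open>
  All three coordinate changes are canonical.  A system with Hamiltonian \<open>H\<close> is therefore polynomial
  and Hamiltonian in the new coordinates only if \<open>H\<close> itself, up to an element of \<open>C(t)\<close>, is a polynomial
  in them; for the third chart, which depends on \<open>t\<close>, it is \<open>H + x\<close>.  This is proved with
  the chain rule and the fact that a rational function with zero partial derivatives is constant
  (\<open>hamiltonian_up_to_constant\<close>).  Evaluating along curves that run into the hypersurface added
  by a chart turns the condition into the absence of a pole at \<open>s = 0\<close> for an explicit
  family of Laurent polynomials in \<open>s\<close>.  From then on \<open>t\<close> and the \<open>\<alpha>\<^sub>i\<close> are merely elements of a field
  of characteristic zero, and the conditions are inhomogeneous linear equations for the coefficients of \<open>H\<close>.

  The Hamiltonian \<open>K\<close> of the asserted system satisfies these conditions, with correction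
  \<open>(2 \<alpha>\<^sub>1 + 2 \<alpha>\<^sub>2 + \<alpha>\<^sub>3) x = x\<close> in the third chart.  For uniqueness, consider
  \<open>D = H - r K\<close>, where \<open>r\<close> is chosen so that \<open>D\<close> contains no \<open>y\<^sup>2\<close>.  It satisfies the conditions
  with correction \<open>(1 - r) x\<close>, and \<open>rigidity\<close> shows that \<open>D\<close> is constant and \<open>r = 1\<close>.

  Rigidity is an argument with leading forms.  Give \<open>x, y, z, w\<close> the weights 2, 4, 2, 3.  The
  conditions are closed under limits (\<open>regular_at_0_limit\<close>), so the part of \<open>D\<close> of highest weight
  satisfies their limit under the corresponding rescaling, in which \<open>t\<close>, the \<open>\<alpha>\<^sub>i\<close> and the correction have
  disappeared (\<open>leading_form_regular\<close>).  For the first two charts this says that \<open>x ^ i y ^ j z ^ k w ^ l\<close>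
  occurs only if \<open>i \<le> 2 j\<close> and \<open>k \<le> 2 l\<close>.  The third gives binomial relations between
  the coefficients with the same \<open>i + 2 j + k\<close> and \<open>l\<close> (\<open>leading_relations_chart3\<close>).  In total degree at
  most 5 these small systems have only the zero solution, apart from the multiples of \<open>2 y\<^sup>2 - 2 x\<^sup>2 y\<close>,
  the leading form of \<open>K\<close>.  The degree bound is essential here: the square of that leading form has
  degree 6 and satisfies the limit conditions, too.
\<close>

section \<open>Functions without a pole at the origin\<close>

text \<open>
  Each of the three charts overlaps the original one exactly where a single new coordinate \<open>s\<close> is
  nonzero.  Fixing the other three coordinates turns polynomiality in the
  chart into a condition on functions of \<open>s\<close> alone: no pole at \<open>s = 0\<close>.  The point \<open>s = 0\<close> is
  excluded because the substituted functions involve \<open>1 / s\<close>.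
\<close>

definition regular_at_0 :: "('a::field \<Rightarrow> 'a) \<Rightarrow> bool" where
  "regular_at_0 f \<longleftrightarrow> (\<exists>g. \<forall>s. s \<noteq> 0 \<longrightarrow> f s = poly g s)"

lemma regular_at_0_const: "regular_at_0 (\<lambda>s. a)"
  unfolding regular_at_0_def by (rule exI[of _ "[:a:]"]) simp

lemma regular_at_0_ident: "regular_at_0 (\<lambda>s. s)"
  unfolding regular_at_0_def by (rule exI[of _ "[:0, 1:]"]) simp

lemma regular_at_0_add:
  assumes "regular_at_0 f" "regular_at_0 g" shows "regular_at_0 (\<lambda>s. f s + g s)"
proof -
  obtain p q where "\<forall>s. s \<noteq> 0 \<longrightarrow> f s = poly p s" "\<forall>s. s \<noteq> 0 \<longrightarrow> g s = poly q s"
    using assms unfolding regular_at_0_def by blast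
  then show ?thesis unfolding regular_at_0_def by (intro exI[of _ "p + q"]) simp
qed

lemma regular_at_0_mult:
  assumes "regular_at_0 f" "regular_at_0 g" shows "regular_at_0 (\<lambda>s. f s * g s)"
proof -
  obtain p q where "\<forall>s. s \<noteq> 0 \<longrightarrow> f s = poly p s" "\<forall>s. s \<noteq> 0 \<longrightarrow> g s = poly q s"
    using assms unfolding regular_at_0_def by blast
  then show ?thesis unfolding regular_at_0_def by (intro exI[of _ "p * q"]) simp
qed

lemma regular_at_0_uminus: "regular_at_0 f \<Longrightarrow> regular_at_0 (\<lambda>s. - f s)"
  using regular_at_0_mult[OF regular_at_0_const[of "-1"]] by simp

lemma regular_at_0_diff: "regular_at_0 f \<Longrightarrow> regular_at_0 g \<Longrightarrow> regular_at_0 (\<lambda>s. f s - g s)"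
  using regular_at_0_add[OF _ regular_at_0_uminus] by simp

lemma regular_at_0_power: "regular_at_0 f \<Longrightarrow> regular_at_0 (\<lambda>s. f s ^ n)"
  by (induction n) (auto intro: regular_at_0_const regular_at_0_mult)

lemmas regular_intros = regular_at_0_const regular_at_0_ident regular_at_0_add regular_at_0_mult
  regular_at_0_uminus regular_at_0_diff regular_at_0_power

lemma regular_at_0_cong:
  assumes "regular_at_0 f" "\<And>s. s \<noteq> 0 \<Longrightarrow> f s = g s" shows "regular_at_0 g"
  using assms unfolding regular_at_0_def by metis

text \<open>
  Functions that are Laurent polynomials in \<open>s\<close> with coefficients polynomial in a deformation
  parameter \<open>\<epsilon>\<close>; the outer variable of \<open>B\<close> is \<open>s\<close>.
\<close>

definition laurent :: "('a::field \<Rightarrow> 'a \<Rightarrow> 'a) \<Rightarrow> bool" where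
  "laurent F \<longleftrightarrow> (\<exists>n B. \<forall>s \<epsilon>. s \<noteq> 0 \<longrightarrow> s ^ n * F s \<epsilon> = poly (poly B [:s:]) \<epsilon>)"

lemma laurentI:
  assumes "\<And>s \<epsilon>. s \<noteq> 0 \<Longrightarrow> s ^ n * F s \<epsilon> = poly (poly B [:s:]) \<epsilon>" shows "laurent F"
  using assms unfolding laurent_def by blast

lemma laurent_const: "laurent (\<lambda>s \<epsilon>. a)"
  by (rule laurentI[of 0 _ "[:[:a:]:]"]) simp

lemma laurent_fst: "laurent (\<lambda>s \<epsilon>. s)"
  by (rule laurentI[of 0 _ "[:0, 1:]"]) simp

lemma laurent_inverse: "laurent (\<lambda>s \<epsilon>. 1 / s)"
  by (rule laurentI[of 1 _ "1"]) simp

lemma laurent_snd: "laurent (\<lambda>s \<epsilon>. \<epsilon>)"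
  by (rule laurentI[of 0 _ "[:[:0, 1:]:]"]) simp

lemma laurent_mult:
  assumes "laurent F" "laurent G" shows "laurent (\<lambda>s \<epsilon>. F s \<epsilon> * G s \<epsilon>)"
proof -
  obtain n B where F: "\<And>s \<epsilon>. s \<noteq> 0 \<Longrightarrow> s ^ n * F s \<epsilon> = poly (poly B [:s:]) \<epsilon>"
    using assms unfolding laurent_def by blast
  obtain m C where G: "\<And>s \<epsilon>. s \<noteq> 0 \<Longrightarrow> s ^ m * G s \<epsilon> = poly (poly C [:s:]) \<epsilon>"
    using assms unfolding laurent_def by blast
  show ?thesis
    by (rule laurentI[of "n + m" _ "B * C"]) (simp add: F[symmetric] G[symmetric] power_add)
qed

lemma laurent_add:
  assumes "laurent F" "laurent G" shows "laurent (\<lambda>s \<epsilon>. F s \<epsilon> + G s \<epsilon>)"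
proof -
  obtain n B where F: "\<And>s \<epsilon>. s \<noteq> 0 \<Longrightarrow> s ^ n * F s \<epsilon> = poly (poly B [:s:]) \<epsilon>"
    using assms unfolding laurent_def by blast
  obtain m C where G: "\<And>s \<epsilon>. s \<noteq> 0 \<Longrightarrow> s ^ m * G s \<epsilon> = poly (poly C [:s:]) \<epsilon>"
    using assms unfolding laurent_def by blast
  show ?thesis
  proof (rule laurentI[of "n + m" _ "[:0, 1:] ^ m * B + [:0, 1:] ^ n * C"])
    fix s \<epsilon> :: 'a assume "s \<noteq> 0"
    then show "s ^ (n + m) * (F s \<epsilon> + G s \<epsilon>) =
        poly (poly ([:0, 1:] ^ m * B + [:0, 1:] ^ n * C) [:s:]) \<epsilon>"
      by (simp add: F[symmetric] G[symmetric] power_add algebra_simps)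
  qed
qed

lemma laurent_power: "laurent F \<Longrightarrow> laurent (\<lambda>s \<epsilon>. F s \<epsilon> ^ n)"
  by (induction n) (auto intro: laurent_const laurent_mult)

lemma laurent_uminus: "laurent F \<Longrightarrow> laurent (\<lambda>s \<epsilon>. - F s \<epsilon>)"
  using laurent_mult[OF laurent_const[of "-1"]] by simp

lemma laurent_diff: "laurent F \<Longrightarrow> laurent G \<Longrightarrow> laurent (\<lambda>s \<epsilon>. F s \<epsilon> - G s \<epsilon>)"
  using laurent_add[OF _ laurent_uminus] by simp

lemma laurent_divide: "laurent F \<Longrightarrow> laurent (\<lambda>s \<epsilon>. F s \<epsilon> / s)"
  using laurent_mult[OF _ laurent_inverse] by simp

lemma laurent_divide_power: "laurent F \<Longrightarrow> laurent (\<lambda>s \<epsilon>. F s \<epsilon> / s ^ n)"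
  by (induction n) (auto dest: laurent_divide simp: mult.commute)

lemma laurent_sum: "(\<And>a. a \<in> A \<Longrightarrow> laurent (F a)) \<Longrightarrow> laurent (\<lambda>s \<epsilon>. \<Sum>a\<in>A. F a s \<epsilon>)"
  by (induction A rule: infinite_finite_induct) (auto intro: laurent_const laurent_add)

lemmas laurent_intros = laurent_const laurent_fst laurent_snd laurent_mult laurent_add
  laurent_power laurent_uminus laurent_diff laurent_divide laurent_divide_power laurent_sum

lemma poly_eqI_nonzero:
  fixes p q :: "'a::field_char_0 poly"
  assumes "\<And>s. s \<noteq> 0 \<Longrightarrow> poly p s = poly q s"
  shows "p = q"
proof -
  have "poly ([:0, 1:] * (p - q)) s = 0" for s
    using assms[of s] by (cases "s = 0") auto
  then have "[:0, 1:] * (p - q) = 0" using poly_all_0_iff_0 by blast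
  then show ?thesis by simp
qed

lemma poly_poly_const: "poly (poly B [:s:]) \<epsilon> = poly (map_poly (\<lambda>r. poly r \<epsilon>) B) s"
  by (induction B) (simp_all add: map_poly_pCons)

text \<open>
  Absence of a pole is a closed condition: each polar coefficient is a polynomial in \<open>\<epsilon>\<close>, and a
  polynomial that vanishes at all \<open>\<epsilon> \<noteq> 0\<close> also vanishes at \<open>\<epsilon> = 0\<close>.
\<close>

lemma regular_at_0_limit:
  fixes F :: "'a::field_char_0 \<Rightarrow> 'a \<Rightarrow> 'a"
  assumes "laurent F" and reg: "\<And>\<epsilon>. \<epsilon> \<noteq> 0 \<Longrightarrow> regular_at_0 (\<lambda>s. F s \<epsilon>)"
  shows "regular_at_0 (\<lambda>s. F s 0)"
proof -
  obtain n B where B: "\<And>s \<epsilon>. s \<noteq> 0 \<Longrightarrow> s ^ n * F s \<epsilon> = poly (poly B [:s:]) \<epsilon>"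
    using assms unfolding laurent_def by blast
  have low: "coeff B a = 0" if "a < n" for a
  proof (rule poly_eqI_nonzero)
    fix \<epsilon> :: 'a assume "\<epsilon> \<noteq> 0"
    then obtain g where g: "\<And>s. s \<noteq> 0 \<Longrightarrow> F s \<epsilon> = poly g s"
      using reg unfolding regular_at_0_def by blast
    have "map_poly (\<lambda>r. poly r \<epsilon>) B = monom 1 n * g"
    proof (rule poly_eqI_nonzero)
      fix s :: 'a assume "s \<noteq> 0"
      then show "poly (map_poly (\<lambda>r. poly r \<epsilon>) B) s = poly (monom 1 n * g) s"
        using B[of s \<epsilon>] g[of s] by (simp add: poly_poly_const poly_monom)
    qed
    then have "coeff (map_poly (\<lambda>r. poly r \<epsilon>) B) a = coeff (monom 1 n * g) a" by simp
    then show "poly (coeff B a) \<epsilon> = poly 0 \<epsilon>"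
      using that by (simp add: coeff_map_poly coeff_monom_mult)
  qed
  define C where "C = map_poly (\<lambda>r. poly r 0) B"
  have "monom 1 n dvd C"
    using low by (simp add: monom_1_dvd_iff' C_def coeff_map_poly)
  then obtain g where g: "C = monom 1 n * g" by (auto elim: dvdE)
  have "F s 0 = poly g s" if "s \<noteq> 0" for s
  proof -
    have "s ^ n * F s 0 = s ^ n * poly g s"
      using B[OF that, of 0] g by (simp add: poly_poly_const C_def poly_monom)
    then show ?thesis using that by simp
  qed
  then show ?thesis unfolding regular_at_0_def by blast
qed

lemma power_coeffs_vanish:
  fixes u :: "'i \<Rightarrow> 'a::field_char_0"
  assumes "finite A" "\<And>y. (\<Sum>a\<in>A. u a * y ^ e a) = 0"
  shows "(\<Sum>a\<in>{a\<in>A. e a = d}. u a) = 0"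
proof -
  define p where "p = (\<Sum>a\<in>A. monom (u a) (e a))"
  have "poly p y = 0" for y
    using assms(2) by (simp add: p_def poly_sum poly_monom)
  then have "p = 0" using poly_all_0_iff_0 by blast
  then have "coeff p d = 0" by simp
  then show ?thesis using assms(1) by (simp add: p_def coeff_sum sum.inter_filter)
qed

lemma polar_coeffs_vanish:
  fixes u :: "'i \<Rightarrow> 'a::field_char_0"
  assumes A: "finite A" and reg: "regular_at_0 (\<lambda>s. \<Sum>a\<in>A. u a * s ^ f a / s ^ g a)" and "n > 0"
  shows "(\<Sum>a\<in>{a\<in>A. g a = f a + n}. u a) = 0"
proof -
  obtain r where r: "\<And>s. s \<noteq> 0 \<Longrightarrow> (\<Sum>a\<in>A. u a * s ^ f a / s ^ g a) = poly r s"
    using reg unfolding regular_at_0_def by blast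
  define M where "M = n + (\<Sum>a\<in>A. g a)"
  have M: "g a \<le> M" if "a \<in> A" for a
    unfolding M_def using that A by (meson member_le_sum trans_le_add2 zero_le)
  define p where "p = (\<Sum>a\<in>A. monom (u a) (f a + (M - g a)))"
  have "p = monom 1 M * r"
  proof (rule poly_eqI_nonzero)
    fix s :: 'a assume s: "s \<noteq> 0"
    have "poly p s = (\<Sum>a\<in>A. s ^ M * (u a * s ^ f a / s ^ g a))"
      unfolding p_def poly_sum
    proof (intro sum.cong refl)
      fix a assume "a \<in> A"
      have "s ^ M = s ^ (M - g a) * s ^ g a"
        using M[OF \<open>a \<in> A\<close>] by (simp flip: power_add)
      then show "poly (monom (u a) (f a + (M - g a))) s = s ^ M * (u a * s ^ f a / s ^ g a)"
        using s by (simp add: poly_monom power_add)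
    qed
    then show "poly p s = poly (monom 1 M * r) s"
      unfolding sum_distrib_left[symmetric] r[OF s] by (simp add: poly_monom)
  qed
  then have "coeff p (M - n) = 0"
    using \<open>n > 0\<close> by (simp add: coeff_monom_mult M_def)
  moreover have "coeff p (M - n) = (\<Sum>a\<in>A. if g a = f a + n then u a else 0)"
    unfolding p_def coeff_sum
  proof (intro sum.cong refl)
    fix a assume "a \<in> A"
    moreover have "n \<le> M" by (simp add: M_def)
    ultimately have "f a + (M - g a) = M - n \<longleftrightarrow> g a = f a + n"
      using M[of a] by linarith
    then show "coeff (monom (u a) (f a + (M - g a))) (M - n) = (if g a = f a + n then u a else 0)"
      by simp
  qed
  ultimately show ?thesis using A by (simp add: sum.inter_filter)
qed

text \<open>
  Reads off coefficients of a Laurent polynomial in \<open>s\<close> whose coefficients are polynomials in three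
  further variables.  The index set may list the same monomial several times, so only sums of
  coefficients over equal exponents are known to vanish.
\<close>

lemma polar_coeffs_vanish3:
  fixes u :: "'i \<Rightarrow> 'a::field_char_0"
  assumes A: "finite A"
    and reg: "\<And>y1 y2 y3. regular_at_0
      (\<lambda>s. \<Sum>a\<in>A. u a * y1 ^ e1 a * y2 ^ e2 a * y3 ^ e3 a * s ^ f a / s ^ g a)"
    and "n > 0"
  shows "(\<Sum>a\<in>{a\<in>A. g a = f a + n \<and> e1 a = d1 \<and> e2 a = d2 \<and> e3 a = d3}. u a) = 0"
proof -
  let ?A = "{a\<in>A. g a = f a + n}"
  have "(\<Sum>a\<in>?A. u a * y1 ^ e1 a * y2 ^ e2 a * y3 ^ e3 a) = 0" for y1 y2 y3
    by (rule polar_coeffs_vanish[OF A reg \<open>n > 0\<close>])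
  then have "(\<Sum>a\<in>{a\<in>?A. e3 a = d3}. u a * y1 ^ e1 a * y2 ^ e2 a) = 0" for y1 y2
    using A by (intro power_coeffs_vanish[where e = e3]) auto
  then have "(\<Sum>a\<in>{a\<in>{a\<in>?A. e3 a = d3}. e2 a = d2}. u a * y1 ^ e1 a) = 0" for y1
    using A by (intro power_coeffs_vanish[where e = e2]) auto
  then have "(\<Sum>a\<in>{a\<in>{a\<in>{a\<in>?A. e3 a = d3}. e2 a = d2}. e1 a = d1}. u a) = 0"
    using A by (intro power_coeffs_vanish[where e = e1]) auto
  moreover have "{a\<in>{a\<in>{a\<in>?A. e3 a = d3}. e2 a = d2}. e1 a = d1} =
      {a\<in>A. g a = f a + n \<and> e1 a = d1 \<and> e2 a = d2 \<and> e3 a = d3}" by auto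
  ultimately show ?thesis by simp
qed

section \<open>Evaluation of polynomials in four variables\<close>

text \<open>
  Evaluation of an iterated polynomial after applying \<open>h\<close> to its coefficients.  It covers both the
  substitution of rational functions (\<open>h\<close> the embedding of the coefficient field) and the evaluation
  at points (\<open>h\<close> the identity).
\<close>

definition eval4 ::
    "('r::zero \<Rightarrow> 'b::comm_ring_1) \<Rightarrow> 'b \<Rightarrow> 'b \<Rightarrow> 'b \<Rightarrow> 'b \<Rightarrow> 'r poly poly poly poly \<Rightarrow> 'b" where
  "eval4 h a b c d p =
    poly (map_poly (\<lambda>p3. poly (map_poly (\<lambda>p2. poly (map_poly (\<lambda>p1.
      poly (map_poly h p1) a) p2) b) p3) c) p) d"

definition is_ring_hom :: "('r::comm_ring_1 \<Rightarrow> 'b::comm_ring_1) \<Rightarrow> bool" where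
  "is_ring_hom h \<longleftrightarrow> h 0 = 0 \<and> h 1 = 1 \<and> (\<forall>a b. h (a + b) = h a + h b) \<and> (\<forall>a b. h (a * b) = h a * h b)"

lemma is_ring_homD:
  assumes "is_ring_hom h"
  shows "h 0 = 0" "h 1 = 1" "h (a + b) = h a + h b" "h (a * b) = h a * h b"
    "h (- a) = - h a" "h (a - b) = h a - h b" "h (a ^ n) = h a ^ n"
    "h (of_nat m) = of_nat m" "h (numeral k) = numeral k"
proof -
  note assms[unfolded is_ring_hom_def]
  then have 1: "h 0 = 0" "h 1 = 1" "\<And>a b. h (a + b) = h a + h b" "\<And>a b. h (a * b) = h a * h b"
    by blast+
  then show "h 0 = 0" "h 1 = 1" "h (a + b) = h a + h b" "h (a * b) = h a * h b" by auto
  have 2: "h (- a) = - h a" for a using 1(3)[of a "- a"] 1(1) by (simp add: eq_neg_iff_add_eq_0 add.commute)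
  then show "h (- a) = - h a" .
  show "h (a - b) = h a - h b" using 1(3)[of a "- b"] 2[of b] by simp
  show "h (a ^ n) = h a ^ n" by (induction n) (simp_all add: 1)
  have 3: "h (of_nat m) = of_nat m" for m by (induction m) (simp_all add: 1)
  then show "h (of_nat m) = of_nat m" .
  show "h (numeral k) = numeral k" using 3[of "numeral k"] by simp
qed

lemma is_ring_hom_poly_map_poly:
  assumes "is_ring_hom h"
  shows "is_ring_hom (\<lambda>p. poly (map_poly h p) a)"
proof -
  note h = is_ring_homD[OF assms]
  have add: "map_poly h (p + q) = map_poly h p + map_poly h q" for p q
    by (simp add: poly_eq_iff coeff_map_poly h)
  have smult: "map_poly h (smult c p) = smult (h c) (map_poly h p)" for c p
    by (simp add: poly_eq_iff coeff_map_poly h)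
  have mult: "map_poly h (p * q) = map_poly h p * map_poly h q" for p q
    by (induction p) (simp_all add: add smult map_poly_pCons h)
  show ?thesis
    by (simp add: is_ring_hom_def add mult h map_poly_1)
qed

lemma is_ring_hom_eval4: "is_ring_hom h \<Longrightarrow> is_ring_hom (eval4 h a b c d)"
  unfolding eval4_def by (intro is_ring_hom_poly_map_poly)

abbreviation ev :: "'a::comm_ring_1 poly poly poly poly \<Rightarrow> 'a \<Rightarrow> 'a \<Rightarrow> 'a \<Rightarrow> 'a \<Rightarrow> 'a" where
  "ev P x y z w \<equiv> eval4 (\<lambda>r. r) x y z w P"

lemma is_ring_hom_ident: "is_ring_hom (\<lambda>r. r)"
  by (simp add: is_ring_hom_def)

lemmas ev_simps = is_ring_homD[OF is_ring_hom_eval4[OF is_ring_hom_ident]]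

definition coeff4 :: "'a::zero poly poly poly poly \<Rightarrow> nat \<Rightarrow> nat \<Rightarrow> nat \<Rightarrow> nat \<Rightarrow> 'a" where
  "coeff4 P i j k l = coeff (coeff (coeff (coeff P l) k) j) i"

lemma coeff4_eqI:
  assumes "\<And>i j k l. coeff4 P i j k l = coeff4 Q i j k l" shows "P = Q"
  using assms by (simp add: poly_eq_iff coeff4_def)

lemma poly_map_poly_bounded:
  fixes h :: "'r::zero \<Rightarrow> 'b::comm_ring_1"
  assumes "h 0 = 0" "\<And>i. coeff p i \<noteq> 0 \<Longrightarrow> i \<le> n"
  shows "poly (map_poly h p) a = (\<Sum>i\<le>n. h (coeff p i) * a ^ i)"
proof -
  have "degree (map_poly h p) \<le> n"
  proof (intro degree_le allI impI)
    fix i assume "i > n"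
    then have "coeff p i = 0" using assms(2) leD by blast
    then show "coeff (map_poly h p) i = 0" by (simp add: coeff_map_poly assms(1))
  qed
  then have "(\<Sum>i\<le>degree (map_poly h p). coeff (map_poly h p) i * a ^ i) =
      (\<Sum>i\<le>n. coeff (map_poly h p) i * a ^ i)"
    by (intro sum.mono_neutral_left) (auto simp: coeff_eq_0)
  then show ?thesis by (simp add: poly_altdef coeff_map_poly assms)
qed

text \<open>A box of exponents that contains all monomials of total degree at most 5.\<close>
definition exponents :: "(nat \<times> nat \<times> nat \<times> nat) set" where
  "exponents = {..5} \<times> {..5} \<times> {..5} \<times> {..5}"

lemma finite_exponents: "finite exponents"
  by (simp add: exponents_def)

lemma ev_altdef:
  assumes "\<And>i j k l. coeff4 P i j k l \<noteq> 0 \<Longrightarrow> i \<le> 5 \<and> j \<le> 5 \<and> k \<le> 5 \<and> l \<le> 5"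
  shows "ev P x y z w = (\<Sum>(i, j, k, l)\<in>exponents. coeff4 P i j k l * x ^ i * y ^ j * z ^ k * w ^ l)"
proof -
  have l: "l \<le> 5" if "coeff P l \<noteq> 0" for l
    using that assms[of _ _ _ l] by (fastforce simp: coeff4_def poly_eq_iff)
  have k: "k \<le> 5" if "coeff (coeff P l) k \<noteq> 0" for k l
    using that assms[of _ _ k l] by (fastforce simp: coeff4_def poly_eq_iff)
  have j: "j \<le> 5" if "coeff (coeff (coeff P l) k) j \<noteq> 0" for j k l
    using that assms[of _ j k l] by (fastforce simp: coeff4_def poly_eq_iff)
  have i: "i \<le> 5" if "coeff (coeff (coeff (coeff P l) k) j) i \<noteq> 0" for i j k l
    using that assms[of i j k l] by (auto simp: coeff4_def)
  have inner: "poly (coeff (coeff (coeff P l) k) j) x =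
      (\<Sum>i\<le>5. coeff (coeff (coeff (coeff P l) k) j) i * x ^ i)" for j k l
    using poly_map_poly_bounded[of "\<lambda>r. r" "coeff (coeff (coeff P l) k) j" 5 x] i by simp
  have "ev P x y z w = (\<Sum>l\<le>5. (\<Sum>k\<le>5. (\<Sum>j\<le>5. (\<Sum>i\<le>5.
      coeff4 P i j k l * x ^ i) * y ^ j) * z ^ k) * w ^ l)"
    unfolding eval4_def coeff4_def
    by (simp add: poly_map_poly_bounded[where n = 5] inner j k l)
  also have "\<dots> = (\<Sum>l\<le>5. \<Sum>k\<le>5. \<Sum>j\<le>5. \<Sum>i\<le>5. coeff4 P i j k l * x ^ i * y ^ j * z ^ k * w ^ l)"
    by (simp add: sum_distrib_right)
  also have "\<dots> = (\<Sum>i\<le>5. \<Sum>j\<le>5. \<Sum>k\<le>5. \<Sum>l\<le>5. coeff4 P i j k l * x ^ i * y ^ j * z ^ k * w ^ l)"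
    (is "(\<Sum>l\<le>5. \<Sum>k\<le>5. \<Sum>j\<le>5. \<Sum>i\<le>5. ?f i j k l) = _")
  proof -
    have "(\<Sum>l\<le>5. \<Sum>k\<le>5. \<Sum>j\<le>5. \<Sum>i\<le>5. ?f i j k l) = (\<Sum>l\<le>5. \<Sum>k\<le>5. \<Sum>i\<le>5. \<Sum>j\<le>5. ?f i j k l)"
      by (intro sum.cong refl sum.swap)
    also have "\<dots> = (\<Sum>l\<le>5. \<Sum>i\<le>5. \<Sum>k\<le>5. \<Sum>j\<le>5. ?f i j k l)"
      by (intro sum.cong refl sum.swap)
    also have "\<dots> = (\<Sum>i\<le>5. \<Sum>l\<le>5. \<Sum>k\<le>5. \<Sum>j\<le>5. ?f i j k l)"
      by (rule sum.swap)
    also have "\<dots> = (\<Sum>i\<le>5. \<Sum>l\<le>5. \<Sum>j\<le>5. \<Sum>k\<le>5. ?f i j k l)"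
      by (intro sum.cong refl sum.swap)
    also have "\<dots> = (\<Sum>i\<le>5. \<Sum>j\<le>5. \<Sum>l\<le>5. \<Sum>k\<le>5. ?f i j k l)"
      by (intro sum.cong refl sum.swap)
    also have "\<dots> = (\<Sum>i\<le>5. \<Sum>j\<le>5. \<Sum>k\<le>5. \<Sum>l\<le>5. ?f i j k l)"
      by (intro sum.cong refl sum.swap)
    finally show ?thesis .
  qed
  also have "\<dots> = (\<Sum>(i, j, k, l)\<in>exponents. ?f i j k l)"
    by (simp add: exponents_def sum.cartesian_product')
  finally show ?thesis .
qed

section \<open>Leading forms\<close>

text \<open>
  A grading in which, along the curves of the third chart, the lowest-order part of every coordinate
  is homogeneous and all parameters are lost in the limit.  The weight 3 of \<open>w\<close> (rather than 4, for
  which the equations with zero parameters are homogeneous) makes the contribution \<open>w\<close> to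
  \<open>y = x\<^sup>2 + w + t + \<dots>\<close> subdominant too.  This decouples the monomials with different
  powers of \<open>w\<close>.
\<close>

definition weight :: "nat \<times> nat \<times> nat \<times> nat \<Rightarrow> nat" where
  "weight = (\<lambda>(i, j, k, l). 2 * i + 4 * j + 2 * k + 3 * l)"

text \<open>
  Rescaling the coordinates by powers of \<open>\<epsilon>\<close> according to their weights and multiplying by \<open>\<epsilon> ^ N\<close>
  produces a family that is polynomial in \<open>\<epsilon>\<close> and whose value at \<open>\<epsilon> = 0\<close> is the part of top weight
  \<open>N\<close>.  By closedness the regularity of the family passes to that part.  The term \<open>e / s\<close> comes from
  the correction \<open>e x\<close> to the Hamiltonian, which has weight 2, and so disappears as soon as \<open>N > 2\<close>.
\<close>

lemma leading_form_regular:
  fixes c :: "nat \<times> nat \<times> nat \<times> nat \<Rightarrow> 'a::field_char_0"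
  assumes top: "\<And>\<mu>. \<mu> \<in> exponents \<Longrightarrow> weight \<mu> > N \<Longrightarrow> c \<mu> = 0"
    and corr: "e = 0 \<or> N > 2"
    and L: "laurent fx" "laurent fy" "laurent fz" "laurent fw"
    and reg: "\<And>\<epsilon>. \<epsilon> \<noteq> 0 \<Longrightarrow> regular_at_0 (\<lambda>s. (\<Sum>(i, j, k, l)\<in>exponents. c (i, j, k, l) *
        (fx s \<epsilon> / \<epsilon> ^ 2) ^ i * (fy s \<epsilon> / \<epsilon> ^ 4) ^ j * (fz s \<epsilon> / \<epsilon> ^ 2) ^ k * (fw s \<epsilon> / \<epsilon> ^ 3) ^ l)
        + e / (\<epsilon> ^ 2 * s))"
  shows "regular_at_0 (\<lambda>s. \<Sum>(i, j, k, l)\<in>{\<mu>\<in>exponents. weight \<mu> = N}. c (i, j, k, l) *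
        fx s 0 ^ i * fy s 0 ^ j * fz s 0 ^ k * fw s 0 ^ l)"
proof -
  define F where "F = (\<lambda>s \<epsilon>. (\<Sum>\<mu>\<in>exponents. case \<mu> of (i, j, k, l) \<Rightarrow>
      \<epsilon> ^ (N - weight \<mu>) * (c \<mu> * fx s \<epsilon> ^ i * fy s \<epsilon> ^ j * fz s \<epsilon> ^ k * fw s \<epsilon> ^ l))
      + \<epsilon> ^ (N - 2) * (e / s))"
  have "laurent F"
    unfolding F_def by (auto intro!: laurent_intros L)
  moreover have "regular_at_0 (\<lambda>s. F s \<epsilon>)" if \<epsilon>: "\<epsilon> \<noteq> 0" for \<epsilon>
  proof -
    have *: "\<epsilon> ^ (N - weight \<mu>) * (c \<mu> * X ^ i * Y ^ j * Z ^ k * W ^ l) =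
      \<epsilon> ^ N * (c \<mu> * (X / \<epsilon> ^ 2) ^ i * (Y / \<epsilon> ^ 4) ^ j * (Z / \<epsilon> ^ 2) ^ k * (W / \<epsilon> ^ 3) ^ l)"
      if "\<mu> \<in> exponents" and \<mu>: "\<mu> = (i, j, k, l)" for \<mu> i j k l X Y Z W
    proof (cases "weight \<mu> \<le> N")
      case True
      have "\<epsilon> ^ N = \<epsilon> ^ (N - weight \<mu>) * \<epsilon> ^ weight \<mu>"
        using True by (simp flip: power_add)
      moreover have "\<epsilon> ^ weight \<mu> = (\<epsilon> ^ 2) ^ i * (\<epsilon> ^ 4) ^ j * (\<epsilon> ^ 2) ^ k * (\<epsilon> ^ 3) ^ l"
        by (simp add: \<mu> weight_def power_add power_mult)
      ultimately show ?thesis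
        using \<epsilon> by (simp add: power_divide)
    qed (use top that in simp)
    have e: "\<epsilon> ^ (N - 2) * (e / s) = \<epsilon> ^ N * (e / (\<epsilon> ^ 2 * s))" for s
    proof (cases "e = 0")
      case False
      then have "\<epsilon> ^ N = \<epsilon> ^ (N - 2) * \<epsilon> ^ 2"
        using corr by (metis False le_add_diff_inverse2 less_imp_le power_add)
      then show ?thesis using \<epsilon> by simp
    qed simp
    have "F s \<epsilon> = \<epsilon> ^ N * ((\<Sum>(i, j, k, l)\<in>exponents. c (i, j, k, l) *
        (fx s \<epsilon> / \<epsilon> ^ 2) ^ i * (fy s \<epsilon> / \<epsilon> ^ 4) ^ j * (fz s \<epsilon> / \<epsilon> ^ 2) ^ k * (fw s \<epsilon> / \<epsilon> ^ 3) ^ l)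
        + e / (\<epsilon> ^ 2 * s))" for s
      unfolding F_def distrib_left e sum_distrib_left
      by (intro arg_cong2[where f = "(+)"] sum.cong refl) (auto simp: *)
    then show ?thesis
      using regular_at_0_mult[OF regular_at_0_const reg[OF \<epsilon>]] by simp
  qed
  ultimately have "regular_at_0 (\<lambda>s. F s 0)"
    by (rule regular_at_0_limit)
  moreover have "F s 0 = (\<Sum>(i, j, k, l)\<in>{\<mu>\<in>exponents. weight \<mu> = N}. c (i, j, k, l) *
        fx s 0 ^ i * fy s 0 ^ j * fz s 0 ^ k * fw s 0 ^ l)" for s
  proof -
    have "0 ^ (N - 2) * (e / s) = 0" using corr by auto
    moreover have "(\<Sum>\<mu>\<in>exponents. case \<mu> of (i, j, k, l) \<Rightarrow>
      0 ^ (N - weight \<mu>) * (c \<mu> * fx s 0 ^ i * fy s 0 ^ j * fz s 0 ^ k * fw s 0 ^ l)) =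
      (\<Sum>\<mu>\<in>exponents. if weight \<mu> = N then case \<mu> of (i, j, k, l) \<Rightarrow>
      c (i, j, k, l) * fx s 0 ^ i * fy s 0 ^ j * fz s 0 ^ k * fw s 0 ^ l else 0)"
      by (intro sum.cong refl) (use top in \<open>auto simp: power_0_left split: prod.splits\<close>)
    ultimately show ?thesis
      unfolding F_def by (simp add: sum.inter_filter finite_exponents)
  qed
  ultimately show ?thesis by simp
qed

text \<open>
  The arguments of \<open>D\<close> are the inverses of the coordinate changes, with \<open>s = x\<^sub>1\<close>, \<open>s = z\<^sub>2\<close> and
  \<open>s = x\<^sub>3\<close> respectively; to save signs, the other letters stand for \<open>y = - y\<^sub>1\<close>, \<open>w = - w\<^sub>2\<close> and
  \<open>y = - y\<^sub>3\<close>, \<open>p = - z\<^sub>3\<close>, \<open>q = - w\<^sub>3\<close>.  The third chart depends on \<open>t\<close>; this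
  adds a multiple \<open>e x\<close> of \<open>x = 1 / s\<close> to the function that has to be regular.
\<close>

definition polynomial_in_chart1 :: "'a::field \<Rightarrow> 'a poly poly poly poly \<Rightarrow> bool" where
  "polynomial_in_chart1 \<alpha>\<^sub>2 D \<longleftrightarrow>
    (\<forall>y z w. regular_at_0 (\<lambda>s. ev D (1 / s) (s ^ 2 * y - \<alpha>\<^sub>2 * s) z w))"

definition polynomial_in_chart2 :: "'a::field \<Rightarrow> 'a poly poly poly poly \<Rightarrow> bool" where
  "polynomial_in_chart2 \<alpha>\<^sub>3 D \<longleftrightarrow>
    (\<forall>x y w. regular_at_0 (\<lambda>s. ev D x y (1 / s) (s ^ 2 * w - \<alpha>\<^sub>3 * s)))"

definition polynomial_in_chart3 ::
    "'a::field \<Rightarrow> 'a \<Rightarrow> 'a \<Rightarrow> 'a poly poly poly poly \<Rightarrow> bool" where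
  "polynomial_in_chart3 \<alpha>\<^sub>1 t e D \<longleftrightarrow>
    (\<forall>y p q. regular_at_0 (\<lambda>s.
      ev D (1 / s) (1 / s ^ 2 + p / s + t - s * (p * q + \<alpha>\<^sub>1) + s ^ 2 * y) (- (1 / s) - s * q) (p / s)
      + e / s))"

lemma regular_at_0_scale:
  assumes "regular_at_0 f" "a \<noteq> 0" shows "regular_at_0 (\<lambda>s. f (a * s))"
proof -
  obtain g where g: "\<And>s. s \<noteq> 0 \<Longrightarrow> f s = poly g s"
    using assms unfolding regular_at_0_def by blast
  show ?thesis unfolding regular_at_0_def
    by (rule exI[of _ "pcompose g [:0, a:]"]) (simp add: poly_pcompose g assms mult.commute)
qed

lemma binomial_sum_upto:
  fixes r :: "'a::comm_ring_1"
  assumes "j \<le> n" shows "(1 + r) ^ j = (\<Sum>a\<le>n. of_nat (j choose a) * r ^ a)"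
proof -
  have "(r + 1) ^ j = (\<Sum>a\<le>j. of_nat (j choose a) * r ^ a)"
    by (simp add: binomial_ring)
  also have "\<dots> = (\<Sum>a\<le>n. of_nat (j choose a) * r ^ a)"
    using assms by (intro sum.mono_neutral_left) (auto simp: binomial_eq_0)
  finally show ?thesis by (simp add: add.commute)
qed

context
  fixes D :: "'a::field_char_0 poly poly poly poly" and N :: nat
  assumes deg: "\<And>i j k l. coeff4 D i j k l \<noteq> 0 \<Longrightarrow> i + j + k + l \<le> 5"
    and top: "\<And>i j k l. weight (i, j, k, l) > N \<Longrightarrow> coeff4 D i j k l = 0"
begin

lemma ev_degree5: "ev D x y z w =
    (\<Sum>(i, j, k, l)\<in>exponents. coeff4 D i j k l * x ^ i * y ^ j * z ^ k * w ^ l)"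
proof (rule ev_altdef)
  fix i j k l assume "coeff4 D i j k l \<noteq> 0"
  from deg[OF this] show "i \<le> 5 \<and> j \<le> 5 \<and> k \<le> 5 \<and> l \<le> 5" by linarith
qed

text \<open>
  To top order the first chart is \<open>x = 1 / s\<close>, \<open>y \<mapsto> s\<^sup>2 y\<close>, so that \<open>x ^ i y ^ j\<close> becomes
  \<open>s ^ (2 j - i) y ^ j\<close>.
\<close>

lemma leading_coeff_chart1:
  assumes ch: "polynomial_in_chart1 \<alpha> D" and "i > 2 * j" and wt: "weight (i, j, k, l) = N"
  shows "coeff4 D i j k l = 0"
proof (rule ccontr)
  assume nz: "coeff4 D i j k l \<noteq> 0"
  let ?c = "\<lambda>(i, j, k, l). coeff4 D i j k l"
  let ?A = "{\<mu>\<in>exponents. weight \<mu> = N}"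
  have "regular_at_0 (\<lambda>s. \<Sum>(i, j, k, l)\<in>?A. ?c (i, j, k, l) *
      (1 / s) ^ i * (s ^ 2 * y - 0 ^ 6 * \<alpha> * s) ^ j * z ^ k * w ^ l)" for y z w
  proof (rule leading_form_regular[where e = 0 and fx = "\<lambda>s \<epsilon>. 1 / s" and
        fy = "\<lambda>s \<epsilon>. s ^ 2 * y - \<epsilon> ^ 6 * \<alpha> * s" and fz = "\<lambda>s \<epsilon>. z" and fw = "\<lambda>s \<epsilon>. w"])
    fix \<epsilon> :: 'a assume \<epsilon>: "\<epsilon> \<noteq> 0"
    \<comment> \<open>The scaling of \<open>s\<close>, \<open>y\<close>, \<open>z\<close>, \<open>w\<close> that induces weights 2, 4, 2, 3 on the original coordinates.\<close>
    have "regular_at_0 (\<lambda>s. ev D (1 / s) (s ^ 2 * (y / \<epsilon> ^ 8) - \<alpha> * s) (z / \<epsilon> ^ 2) (w / \<epsilon> ^ 3))"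
      using ch unfolding polynomial_in_chart1_def by blast
    then have "regular_at_0 (\<lambda>s. ev D (1 / (\<epsilon> ^ 2 * s))
        ((\<epsilon> ^ 2 * s) ^ 2 * (y / \<epsilon> ^ 8) - \<alpha> * (\<epsilon> ^ 2 * s)) (z / \<epsilon> ^ 2) (w / \<epsilon> ^ 3))"
      by (rule regular_at_0_scale) (use \<epsilon> in simp)
    then show "regular_at_0 (\<lambda>s. (\<Sum>(i, j, k, l)\<in>exponents. ?c (i, j, k, l) *
        ((1 / s) / \<epsilon> ^ 2) ^ i * ((s ^ 2 * y - \<epsilon> ^ 6 * \<alpha> * s) / \<epsilon> ^ 4) ^ j *
        (z / \<epsilon> ^ 2) ^ k * (w / \<epsilon> ^ 3) ^ l) + 0 / (\<epsilon> ^ 2 * s))"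
    proof (rule regular_at_0_cong)
      fix s :: 'a assume s: "s \<noteq> 0"
      have y: "(\<epsilon> ^ 2 * s) ^ 2 * (y / \<epsilon> ^ 8) - \<alpha> * (\<epsilon> ^ 2 * s) = (s ^ 2 * y - \<epsilon> ^ 6 * \<alpha> * s) / \<epsilon> ^ 4"
        using \<epsilon> by (simp add: divide_simps) algebra
      have x: "1 / (\<epsilon> ^ 2 * s) = (1 / s) / \<epsilon> ^ 2" by simp
      show "ev D (1 / (\<epsilon> ^ 2 * s)) ((\<epsilon> ^ 2 * s) ^ 2 * (y / \<epsilon> ^ 8) - \<alpha> * (\<epsilon> ^ 2 * s)) (z / \<epsilon> ^ 2) (w / \<epsilon> ^ 3)
        = (\<Sum>(i, j, k, l)\<in>exponents. ?c (i, j, k, l) *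
        ((1 / s) / \<epsilon> ^ 2) ^ i * ((s ^ 2 * y - \<epsilon> ^ 6 * \<alpha> * s) / \<epsilon> ^ 4) ^ j *
        (z / \<epsilon> ^ 2) ^ k * (w / \<epsilon> ^ 3) ^ l) + 0 / (\<epsilon> ^ 2 * s)"
        unfolding x y ev_degree5 by simp
    qed
  qed (use top in \<open>auto intro!: laurent_intros\<close>)
  then have "regular_at_0 (\<lambda>s. \<Sum>\<mu>\<in>?A. ?c \<mu> * y ^ (\<lambda>(i, j, k, l). j) \<mu> * z ^ (\<lambda>(i, j, k, l). k) \<mu> *
      w ^ (\<lambda>(i, j, k, l). l) \<mu> * s ^ (\<lambda>(i, j, k, l). 2 * j) \<mu> / s ^ (\<lambda>(i, j, k, l). i) \<mu>)" for y z w
    by (rule regular_at_0_cong)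
       (auto intro!: sum.cong simp: power_mult power_mult_distrib power_divide)
  then have "(\<Sum>\<mu>\<in>{\<mu>\<in>?A. (\<lambda>(i, j, k, l). i) \<mu> = (\<lambda>(i, j, k, l). 2 * j) \<mu> + (i - 2 * j) \<and>
      (\<lambda>(i, j, k, l). j) \<mu> = j \<and> (\<lambda>(i, j, k, l). k) \<mu> = k \<and> (\<lambda>(i, j, k, l). l) \<mu> = l}. ?c \<mu>) = 0"
    by (intro polar_coeffs_vanish3) (use \<open>i > 2 * j\<close> finite_exponents in auto)
  moreover have "{\<mu>\<in>?A. (\<lambda>(i, j, k, l). i) \<mu> = (\<lambda>(i, j, k, l). 2 * j) \<mu> + (i - 2 * j) \<and>
      (\<lambda>(i, j, k, l). j) \<mu> = j \<and> (\<lambda>(i, j, k, l). k) \<mu> = k \<and> (\<lambda>(i, j, k, l). l) \<mu> = l} =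
      {(i, j, k, l)}"
    using \<open>i > 2 * j\<close> wt deg[OF nz] by (auto simp: exponents_def)
  ultimately show False using nz by simp
qed

lemma leading_coeff_chart2:
  assumes ch: "polynomial_in_chart2 \<alpha> D" and "k > 2 * l" and wt: "weight (i, j, k, l) = N"
  shows "coeff4 D i j k l = 0"
proof (rule ccontr)
  assume nz: "coeff4 D i j k l \<noteq> 0"
  let ?c = "\<lambda>(i, j, k, l). coeff4 D i j k l"
  let ?A = "{\<mu>\<in>exponents. weight \<mu> = N}"
  have "regular_at_0 (\<lambda>s. \<Sum>(i, j, k, l)\<in>?A. ?c (i, j, k, l) *
      x ^ i * y ^ j * (1 / s) ^ k * (s ^ 2 * w - 0 ^ 5 * \<alpha> * s) ^ l)" for x y w
  proof (rule leading_form_regular[where e = 0 and fx = "\<lambda>s \<epsilon>. x" and fy = "\<lambda>s \<epsilon>. y" and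
        fz = "\<lambda>s \<epsilon>. 1 / s" and fw = "\<lambda>s \<epsilon>. s ^ 2 * w - \<epsilon> ^ 5 * \<alpha> * s"])
    fix \<epsilon> :: 'a assume \<epsilon>: "\<epsilon> \<noteq> 0"
    have "regular_at_0 (\<lambda>s. ev D (x / \<epsilon> ^ 2) (y / \<epsilon> ^ 4) (1 / s) (s ^ 2 * (w / \<epsilon> ^ 7) - \<alpha> * s))"
      using ch unfolding polynomial_in_chart2_def by blast
    then have "regular_at_0 (\<lambda>s. ev D (x / \<epsilon> ^ 2) (y / \<epsilon> ^ 4) (1 / (\<epsilon> ^ 2 * s))
        ((\<epsilon> ^ 2 * s) ^ 2 * (w / \<epsilon> ^ 7) - \<alpha> * (\<epsilon> ^ 2 * s)))"
      by (rule regular_at_0_scale) (use \<epsilon> in simp)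
    then show "regular_at_0 (\<lambda>s. (\<Sum>(i, j, k, l)\<in>exponents. ?c (i, j, k, l) *
        (x / \<epsilon> ^ 2) ^ i * (y / \<epsilon> ^ 4) ^ j * ((1 / s) / \<epsilon> ^ 2) ^ k *
        ((s ^ 2 * w - \<epsilon> ^ 5 * \<alpha> * s) / \<epsilon> ^ 3) ^ l) + 0 / (\<epsilon> ^ 2 * s))"
    proof (rule regular_at_0_cong)
      fix s :: 'a assume s: "s \<noteq> 0"
      have w: "(\<epsilon> ^ 2 * s) ^ 2 * (w / \<epsilon> ^ 7) - \<alpha> * (\<epsilon> ^ 2 * s) = (s ^ 2 * w - \<epsilon> ^ 5 * \<alpha> * s) / \<epsilon> ^ 3"
        using \<epsilon> by (simp add: divide_simps) algebra
      have z: "1 / (\<epsilon> ^ 2 * s) = (1 / s) / \<epsilon> ^ 2" by simp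
      show "ev D (x / \<epsilon> ^ 2) (y / \<epsilon> ^ 4) (1 / (\<epsilon> ^ 2 * s))
        ((\<epsilon> ^ 2 * s) ^ 2 * (w / \<epsilon> ^ 7) - \<alpha> * (\<epsilon> ^ 2 * s))
        = (\<Sum>(i, j, k, l)\<in>exponents. ?c (i, j, k, l) *
        (x / \<epsilon> ^ 2) ^ i * (y / \<epsilon> ^ 4) ^ j * ((1 / s) / \<epsilon> ^ 2) ^ k *
        ((s ^ 2 * w - \<epsilon> ^ 5 * \<alpha> * s) / \<epsilon> ^ 3) ^ l) + 0 / (\<epsilon> ^ 2 * s)"
        unfolding z w ev_degree5 by simp
    qed
  qed (use top in \<open>auto intro!: laurent_intros\<close>)
  then have "regular_at_0 (\<lambda>s. \<Sum>\<mu>\<in>?A. ?c \<mu> * x ^ (\<lambda>(i, j, k, l). i) \<mu> * y ^ (\<lambda>(i, j, k, l). j) \<mu> *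
      w ^ (\<lambda>(i, j, k, l). l) \<mu> * s ^ (\<lambda>(i, j, k, l). 2 * l) \<mu> / s ^ (\<lambda>(i, j, k, l). k) \<mu>)" for x y w
    by (rule regular_at_0_cong)
       (auto intro!: sum.cong simp: power_mult power_mult_distrib power_divide)
  then have "(\<Sum>\<mu>\<in>{\<mu>\<in>?A. (\<lambda>(i, j, k, l). k) \<mu> = (\<lambda>(i, j, k, l). 2 * l) \<mu> + (k - 2 * l) \<and>
      (\<lambda>(i, j, k, l). i) \<mu> = i \<and> (\<lambda>(i, j, k, l). j) \<mu> = j \<and> (\<lambda>(i, j, k, l). l) \<mu> = l}. ?c \<mu>) = 0"
    by (intro polar_coeffs_vanish3) (use \<open>k > 2 * l\<close> finite_exponents in auto)
  moreover have "{\<mu>\<in>?A. (\<lambda>(i, j, k, l). k) \<mu> = (\<lambda>(i, j, k, l). 2 * l) \<mu> + (k - 2 * l) \<and>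
      (\<lambda>(i, j, k, l). i) \<mu> = i \<and> (\<lambda>(i, j, k, l). j) \<mu> = j \<and> (\<lambda>(i, j, k, l). l) \<mu> = l} =
      {(i, j, k, l)}"
    using \<open>k > 2 * l\<close> wt deg[OF nz] by (auto simp: exponents_def)
  ultimately show False using nz by simp
qed

text \<open>
  To top order the third chart loses \<open>t\<close>, \<open>\<alpha>\<close> and the \<open>p\<close>-terms of \<open>y\<close>.
\<close>

lemma leading_form_chart3:
  assumes ch: "polynomial_in_chart3 \<alpha> t e D" and "N > 2"
  shows "regular_at_0 (\<lambda>s. \<Sum>(i, j, k, l)\<in>{\<mu>\<in>exponents. weight \<mu> = N}. coeff4 D i j k l *
      (1 / s) ^ i * (1 / s ^ 2 + s ^ 2 * y) ^ j * (- (1 / s) - s * q) ^ k * (p / s) ^ l)"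
proof -
  let ?c = "\<lambda>(i, j, k, l). coeff4 D i j k l"
  let ?y = "\<lambda>s \<epsilon>. 1 / s ^ 2 + \<epsilon> * p / s + \<epsilon> ^ 4 * t - s * (\<epsilon> * p * q + \<epsilon> ^ 6 * \<alpha>) + s ^ 2 * y"
  have "regular_at_0 (\<lambda>s. \<Sum>(i, j, k, l)\<in>{\<mu>\<in>exponents. weight \<mu> = N}. ?c (i, j, k, l) *
      (1 / s) ^ i * ?y s 0 ^ j * (- (1 / s) - s * q) ^ k * (p / s) ^ l)"
  proof (rule leading_form_regular[where e = e and fx = "\<lambda>s \<epsilon>. 1 / s" and fy = ?y and
        fz = "\<lambda>s \<epsilon>. - (1 / s) - s * q" and fw = "\<lambda>s \<epsilon>. p / s"])
    fix \<epsilon> :: 'a assume \<epsilon>: "\<epsilon> \<noteq> 0"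
    let ?Y = "\<lambda>s. 1 / s ^ 2 + (p / \<epsilon>) / s + t - s * ((p / \<epsilon>) * (q / \<epsilon> ^ 4) + \<alpha>) + s ^ 2 * (y / \<epsilon> ^ 8)"
    \<comment> \<open>The weights of \<open>s\<close>, \<open>y\<close>, \<open>p\<close>, \<open>q\<close> are \<open>-2\<close>, 8, 1, 4; those of \<open>t\<close> and \<open>\<alpha>\<close> are 4 and 6.\<close>
    have "regular_at_0 (\<lambda>s. ev D (1 / s) (?Y s) (- (1 / s) - s * (q / \<epsilon> ^ 4)) ((p / \<epsilon>) / s) + e / s)"
      using ch unfolding polynomial_in_chart3_def by blast
    then have "regular_at_0 (\<lambda>s. ev D (1 / (\<epsilon> ^ 2 * s)) (?Y (\<epsilon> ^ 2 * s))
        (- (1 / (\<epsilon> ^ 2 * s)) - (\<epsilon> ^ 2 * s) * (q / \<epsilon> ^ 4)) ((p / \<epsilon>) / (\<epsilon> ^ 2 * s)) + e / (\<epsilon> ^ 2 * s))"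
      by (rule regular_at_0_scale) (use \<epsilon> in simp)
    then show "regular_at_0 (\<lambda>s. (\<Sum>(i, j, k, l)\<in>exponents. ?c (i, j, k, l) *
        ((1 / s) / \<epsilon> ^ 2) ^ i * (?y s \<epsilon> / \<epsilon> ^ 4) ^ j * ((- (1 / s) - s * q) / \<epsilon> ^ 2) ^ k *
        ((p / s) / \<epsilon> ^ 3) ^ l) + e / (\<epsilon> ^ 2 * s))"
    proof (rule regular_at_0_cong)
      fix s :: 'a assume s: "s \<noteq> 0"
      have y: "?Y (\<epsilon> ^ 2 * s) = ?y s \<epsilon> / \<epsilon> ^ 4"
        using \<epsilon> s by (simp add: divide_simps) algebra
      have x: "1 / (\<epsilon> ^ 2 * s) = (1 / s) / \<epsilon> ^ 2" by simp
      have z: "- (1 / s / \<epsilon> ^ 2) - (\<epsilon> ^ 2 * s) * (q / \<epsilon> ^ 4) = (- (1 / s) - s * q) / \<epsilon> ^ 2"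
        using \<epsilon> s by (simp add: divide_simps) algebra
      have w: "(p / \<epsilon>) / (\<epsilon> ^ 2 * s) = (p / s) / \<epsilon> ^ 3"
        using \<epsilon> s by (simp add: divide_simps power2_eq_square power3_eq_cube)
      show "ev D (1 / (\<epsilon> ^ 2 * s)) (?Y (\<epsilon> ^ 2 * s))
        (- (1 / (\<epsilon> ^ 2 * s)) - (\<epsilon> ^ 2 * s) * (q / \<epsilon> ^ 4)) ((p / \<epsilon>) / (\<epsilon> ^ 2 * s)) + e / (\<epsilon> ^ 2 * s)
        = (\<Sum>(i, j, k, l)\<in>exponents. ?c (i, j, k, l) *
        ((1 / s) / \<epsilon> ^ 2) ^ i * (?y s \<epsilon> / \<epsilon> ^ 4) ^ j * ((- (1 / s) - s * q) / \<epsilon> ^ 2) ^ k *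
        ((p / s) / \<epsilon> ^ 3) ^ l) + e / (\<epsilon> ^ 2 * s)"
        unfolding y unfolding w unfolding x z ev_degree5 by simp
    qed
  qed (use top \<open>N > 2\<close> in \<open>auto intro!: laurent_intros\<close>)
  then show ?thesis by simp
qed

end

section \<open>Linear relations within one block\<close>

text \<open>
  The relations \<open>E\<close> say that \<open>\<Sum> (-1) ^ k c\<^sub>j\<^sub>k B ^ j C ^ k\<close> vanishes at \<open>B = C = 1\<close> to order \<open>M + l\<close>,
  where \<open>B - 1\<close> counts with weight 4 and \<open>C - 1\<close> with weight 2.  The rows, \<open>k\<close> fixed, are treated from
  the largest \<open>k\<close> downwards: taking \<open>b = k\<close> isolates row \<open>k\<close>.  The support condition leaves at
  most two neighbouring entries in it, and the relations \<open>a = 0, 1\<close> then form an invertible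
  \<open>2 \<times> 2\<close> system.  The relations
  needed are available, that is \<open>4 a + 2 k < M + l\<close>, except for six pairs \<open>(M, l)\<close>.
\<close>

lemma block_vanishes_generic:
  fixes c :: "nat \<Rightarrow> nat \<Rightarrow> 'a::field_char_0"
  assumes supp: "\<And>j k. c j k \<noteq> 0 \<Longrightarrow>
      2 * j + k \<le> M \<and> M \<le> 4 * j + k \<and> k \<le> 2 * l \<and> M + l \<le> 5 + j \<and> j \<le> 5 \<and> k \<le> 5"
    and E: "\<And>a b. 4 * a + 2 * b < M + l \<Longrightarrow>
      (\<Sum>j\<le>5. \<Sum>k\<le>5. (-1) ^ k * of_nat (j choose a) * of_nat (k choose b) * c j k) = 0"
    and pos: "M + l > 0"
    and gen: "(M, l) \<notin> {(4, 0), (1, 1), (2, 1), (2, 2), (5, 1), (3, 2)}"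
  shows "c j k = 0"
proof (induction "5 - k" arbitrary: j k rule: less_induct)
  case less
  have above: "c j' k' = 0" if "k' > k" for j' k'
    using less[of k' j'] supp[of j' k'] that by (cases "k' \<le> 5") auto
  show ?case
  proof (rule ccontr)
    assume nz: "c j k \<noteq> 0"
    note s = supp[OF nz]
    have row: "(\<Sum>j\<le>5. of_nat (j choose a) * c j k) = 0" if "4 * a + 2 * k < M + l" for a
    proof -
      have "(\<Sum>k'\<le>5. (-1) ^ k' * of_nat (j choose a) * of_nat (k' choose k) * c j k') =
          (-1) ^ k * (of_nat (j choose a) * c j k)" for j
      proof -
        have "(\<Sum>k'\<le>5. (-1) ^ k' * of_nat (j choose a) * of_nat (k' choose k) * c j k') =
          (\<Sum>k'\<in>{k}. (-1) ^ k' * of_nat (j choose a) * of_nat (k' choose k) * c j k')"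
          by (rule sum.mono_neutral_right)
             (use s in \<open>auto intro!: binomial_eq_0 above simp: linorder_neq_iff\<close>)
        then show ?thesis by simp
      qed
      then show ?thesis
        using E[OF that] by (simp add: sum_distrib_left[symmetric])
    qed
    have "2 * k < M + l" 
    proof (rule ccontr)
      assume "\<not> 2 * k < M + l"
      then have "j = 0" and l: "l \<le> 2" and kl: "l \<le> k" "k + l \<le> 5" using s by linarith+
      then have "M = k" using s by linarith
      from l consider "l = 0" | "l = 1" | "l = 2" by linarith
      then show False
      proof cases
        case 1
        then show False using s pos \<open>M = k\<close> by simp
      next
        case 2
        then have "k = 1 \<or> k = 2" using s kl by linarith
        then show False using 2 gen \<open>M = k\<close> by auto
      next
        case 3
        then have "k = 2 \<or> k = 3" using kl by linarith
        then show False using 3 gen \<open>M = k\<close> by auto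
      qed
    qed
    then have r0: "(\<Sum>j\<le>5. c j k) = 0" using row[of 0] by simp
    show False
    proof (cases "\<exists>j'. j' \<noteq> j \<and> c j' k \<noteq> 0")
      case False
      then have "(\<Sum>j\<le>5. c j k) = (\<Sum>j\<in>{j}. c j k)"
        using s by (intro sum.mono_neutral_right) auto
      then show False using r0 nz by simp
    next
      case True
      then obtain j' where j': "j' \<noteq> j" "c j' k \<noteq> 0" by blast
      note s' = supp[OF j'(2)]
      have close: "j2 \<le> j1 + 1" if "c j1 k \<noteq> 0" "c j2 k \<noteq> 0" for j1 j2
        using supp[OF that(1)] supp[OF that(2)] by linarith
      have two: "j'' = j \<or> j'' = j'" if "c j'' k \<noteq> 0" for j''
        using close[OF nz that] close[OF that nz] close[OF that j'(2)] close[OF j'(2) that]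
          close[OF nz j'(2)] close[OF j'(2) nz] j'(1) by linarith
      have red: "(\<Sum>j\<le>5. h j * c j k) = h j * c j k + h j' * c j' k" for h
      proof -
        have "(\<Sum>j\<le>5. h j * c j k) = (\<Sum>j\<in>{j, j'}. h j * c j k)"
          using s s' two by (intro sum.mono_neutral_right) auto
        then show ?thesis using j'(1) by simp
      qed
      have "4 + 2 * k < M + l" 
      proof (rule ccontr)
        assume "\<not> 4 + 2 * k < M + l"
        moreover have "j' = j + 1 \<or> j = j' + 1"
          using close[OF nz j'(2)] close[OF j'(2) nz] j'(1) by linarith
        ultimately have "l \<le> k" "k + l \<le> 2" "M = 4 + k" using s s' by linarith+
        moreover from this have "k = 0 \<and> l = 0 \<or> k = 1 \<and> l = 1" using s by linarith
        ultimately show False using gen by auto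
      qed
      then have "of_nat j * c j k + of_nat j' * c j' k = 0"
        using row[of 1] red[of of_nat] by simp
      moreover have "c j k + c j' k = 0" using r0 red[of "\<lambda>_. 1"] by simp
      then have "c j' k = - c j k" by (simp add: add_eq_0_iff)
      ultimately have "of_nat j * c j k = of_nat j' * c j k" by simp
      then show False using nz j'(1) by simp
    qed
  qed
qed


text \<open>
  In the six remaining blocks the few unknowns are eliminated by hand.  The block \<open>(4, 0)\<close> is
  special: it contains the leading form \<open>2 y\<^sup>2 - 2 x\<^sup>2 y\<close> of an actual solution, so one coefficient
  has to be prescribed.
\<close>

lemma block_vanishes_exceptional:
  fixes c :: "nat \<Rightarrow> nat \<Rightarrow> 'a::field_char_0"
  assumes supp: "\<And>j k. c j k \<noteq> 0 \<Longrightarrow>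
      2 * j + k \<le> M \<and> M \<le> 4 * j + k \<and> k \<le> 2 * l \<and> M + l \<le> 5 + j \<and> j \<le> 5 \<and> k \<le> 5"
    and E: "\<And>a b. 4 * a + 2 * b < M + l \<Longrightarrow>
      (\<Sum>j\<le>5. \<Sum>k\<le>5. (-1) ^ k * of_nat (j choose a) * of_nat (k choose b) * c j k) = 0"
    and exc: "(M, l) \<in> {(4, 0), (1, 1), (2, 1), (2, 2), (5, 1), (3, 2)}"
    and c20: "(M, l) = (4, 0) \<Longrightarrow> c 2 0 = 0"
  shows "c j k = 0"
proof (rule ccontr)
  assume nz: "c j k \<noteq> 0"
  note s = supp[OF nz]
  have z: "c j k = 0" if "\<not> (2 * j + k \<le> M \<and> M \<le> 4 * j + k \<and> k \<le> 2 * l \<and> M + l \<le> 5 + j)" for j k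
    using supp that by blast
  have six: "sum f {..5} = f 0 + f 1 + f 2 + f 3 + f 4 + f 5" for f :: "nat \<Rightarrow> 'a"
    by (simp add: numeral_eq_Suc)
  from exc consider "M = 4" "l = 0" | "M = 1" "l = 1" | "M = 2" "l = 1" | "M = 2" "l = 2"
    | "M = 5" "l = 1" | "M = 3" "l = 2" by auto
  then show False
  proof cases
    case 1
    have "c 1 0 = 0"
      using E[of 0 0] c20 1 by (simp add: six z)
    moreover have "(j, k) \<in> {(2, 0), (1, 0)}" using s 1 by auto
    ultimately show False using nz c20 1 by auto
  next
    case 2
    have "c 0 1 = 0" using E[of 0 0] 2 by (simp add: six z)
    moreover have "j = 0" using s 2 by linarith
    moreover from this have "k = 1" using s 2 by linarith
    ultimately show False using nz by auto
  next
    case 3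
    have "c 0 2 = 0" using E[of 0 1] 3 by (simp add: six z)
    moreover from this have "c 1 0 = 0" using E[of 0 0] 3 by (simp add: six z)
    moreover have "j = 0 \<or> j = 1" using s 3 by linarith
    then have "(j, k) \<in> {(0, 2), (1, 0)}" using s 3 by force
    ultimately show False using nz by auto
  next
    case 4
    have "c 0 2 = 0" using E[of 0 1] 4 by (simp add: six z)
    moreover from this have "c 1 0 = 0" using E[of 0 0] 4 by (simp add: six z)
    moreover have "j = 0 \<or> j = 1" using s 4 by linarith
    then have "(j, k) \<in> {(0, 2), (1, 0)}" using s 4 by force
    ultimately show False using nz by auto
  next
    case 5
    have c12: "c 1 2 = 0" using E[of 0 2] 5 by (simp add: six z binomial_eq_0)
    have "c 1 1 + c 2 1 = 0" using E[of 0 1] c12 5 by (simp add: six z binomial_eq_0 algebra_simps)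
    then have c11: "c 1 1 = - c 2 1" by (simp add: add_eq_0_iff)
    have c20: "c 2 0 = 0" using E[of 0 0] c12 c11 5 by (simp add: six z binomial_eq_0)
    have "c 2 1 = 0" using E[of 1 0] c12 c11 c20 5 by (simp add: six z binomial_eq_0 algebra_simps)
    moreover have "(j, k) \<in> {(1, 2), (1, 1), (2, 1), (2, 0)}" using s 5 by auto
    ultimately show False using nz c12 c11 c20 by auto
  next
    case 6
    have "c 0 3 = 0" using E[of 0 2] 6 by (simp add: six z binomial_eq_0)
    moreover from this have "c 1 1 = 0" using E[of 0 1] 6 by (simp add: six z binomial_eq_0)
    moreover from calculation have "c 1 0 = 0" using E[of 0 0] 6 by (simp add: six z binomial_eq_0)
    moreover have "j = 0 \<or> j = 1" using s 6 by linarith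
    then have "(j, k) \<in> {(0, 3), (1, 1), (1, 0)}" using s 6 by force
    ultimately show False using nz by auto
  qed
qed

section \<open>Rigidity\<close>

context
  fixes D :: "'a::field_char_0 poly poly poly poly" and N :: nat
  assumes deg: "\<And>i j k l. coeff4 D i j k l \<noteq> 0 \<Longrightarrow> i + j + k + l \<le> 5"
    and top: "\<And>i j k l. weight (i, j, k, l) > N \<Longrightarrow> coeff4 D i j k l = 0"
begin

text \<open>
  Since \<open>1 / s\<^sup>2 + s\<^sup>2 y = (1 + s\<^sup>4 y) / s\<^sup>2\<close> and \<open>- 1 / s - s q = - (1 + s\<^sup>2 q) / s\<close>, the monomial
  \<open>x ^ i y ^ j z ^ k w ^ l\<close> contributes \<open>(-1) ^ k (1 + s\<^sup>4 y) ^ j (1 + s\<^sup>2 q) ^ k p ^ l / s ^ (i + 2 j + k + l)\<close> to the leading form.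
  The relation is the vanishing of its coefficient at \<open>y ^ a q ^ b p ^ l\<close>, which has a pole
  exactly if \<open>4 a + 2 b < i + 2 j + k + l = M + l\<close>.  The exponent \<open>i\<close> is determined by \<open>M\<close>, \<open>j\<close>, \<open>k\<close>;
  truncated subtraction makes the case distinction necessary.
\<close>

lemma leading_relations_chart3:
  assumes ch: "polynomial_in_chart3 \<alpha> t e D" and "N > 2"
    and N: "N = 2 * M + 3 * l" and ab: "4 * a + 2 * b < M + l"
  shows "(\<Sum>j\<le>5. \<Sum>k\<le>5. (-1) ^ k * of_nat (j choose a) * of_nat (k choose b) *
      (if 2 * j + k \<le> M then coeff4 D (M - 2 * j - k) j k l else 0)) = 0"
proof (cases "a \<le> 5 \<and> b \<le> 5 \<and> l \<le> 5")
  case False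
  have "coeff4 D i j k l = 0" if "l > 5" for i j k
    using deg[of i j k l] that by force
  then show ?thesis using False by (intro sum.neutral ballI) (auto simp: binomial_eq_0)
next
  case True
  let ?S = "{\<mu>\<in>exponents. weight \<mu> = N}"
  let ?A = "?S \<times> {..5::nat} \<times> {..5::nat}"
  let ?u = "\<lambda>((i, j, k, l), a, b). (-1) ^ k * of_nat (j choose a) * of_nat (k choose b) * coeff4 D i j k l"
  let ?f = "\<lambda>((i, j, k, l), a, b). 4 * a + 2 * b"
  let ?g = "\<lambda>((i, j, k, l), a, b). i + 2 * j + k + l"
  let ?ea = "\<lambda>(\<mu>, a, b). a" and ?eb = "\<lambda>(\<mu>, a, b). b" and ?el = "\<lambda>((i, j, k, l), a, b). l"
  have fin: "finite ?A" using finite_exponents by simp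
  have "regular_at_0 (\<lambda>s. \<Sum>\<nu>\<in>?A. ?u \<nu> * y ^ ?ea \<nu> * q ^ ?eb \<nu> * p ^ ?el \<nu> * s ^ ?f \<nu> / s ^ ?g \<nu>)"
    for y q p
  proof (rule regular_at_0_cong[OF leading_form_chart3[OF deg top ch \<open>N > 2\<close>]])
    fix s :: 'a assume s: "s \<noteq> 0"
    have "c * (1 / s) ^ i * (1 / s ^ 2 + s ^ 2 * y) ^ j * (- (1 / s) - s * q) ^ k * (p / s) ^ l =
        (\<Sum>a\<le>5. \<Sum>b\<le>5. ((-1) ^ k * of_nat (j choose a) * of_nat (k choose b) * c) *
          y ^ a * q ^ b * p ^ l * s ^ (4 * a + 2 * b) / s ^ (i + 2 * j + k + l))"
      if "j \<le> 5" "k \<le> 5" for c i j k l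
    proof -
      have "1 / s ^ 2 + s ^ 2 * y = (1 / s ^ 2) * (1 + s ^ 4 * y)"
        using s by (simp add: field_simps)
      then have y: "(1 / s ^ 2 + s ^ 2 * y) ^ j =
          (1 / s ^ (2 * j)) * (\<Sum>a\<le>5. of_nat (j choose a) * (s ^ (4 * a) * y ^ a))"
        using binomial_sum_upto[OF that(1), of "s ^ 4 * y"]
        by (simp add: power_mult_distrib power_divide flip: power_mult)
      have "- (1 / s) - s * q = (- 1) * (1 / s) * (1 + s ^ 2 * q)"
        using s by (simp add: field_simps power2_eq_square)
      then have z: "(- (1 / s) - s * q) ^ k =
          (- 1) ^ k * (1 / s ^ k) * (\<Sum>b\<le>5. of_nat (k choose b) * (s ^ (2 * b) * q ^ b))"
        using binomial_sum_upto[OF that(2), of "s ^ 2 * q"]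
        by (simp only: power_mult_distrib power_divide power_mult power_one)
      have "c * (1 / s) ^ i * (1 / s ^ 2 + s ^ 2 * y) ^ j * (- (1 / s) - s * q) ^ k * (p / s) ^ l =
          (c * (- 1) ^ k * p ^ l / s ^ (i + 2 * j + k + l)) *
          ((\<Sum>a\<le>5. of_nat (j choose a) * (s ^ (4 * a) * y ^ a)) *
           (\<Sum>b\<le>5. of_nat (k choose b) * (s ^ (2 * b) * q ^ b)))"
        unfolding y z by (simp add: power_add power_divide)
      also have "\<dots> = (\<Sum>a\<le>5. \<Sum>b\<le>5. ((-1) ^ k * of_nat (j choose a) * of_nat (k choose b) * c) *
          y ^ a * q ^ b * p ^ l * s ^ (4 * a + 2 * b) / s ^ (i + 2 * j + k + l))"
        unfolding sum_product unfolding sum_distrib_left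
        by (intro sum.cong refl) (simp add: power_add mult_ac)
      finally show ?thesis .
    qed
    note expand = this
    have "(\<Sum>(i, j, k, l)\<in>?S. coeff4 D i j k l * (1 / s) ^ i * (1 / s ^ 2 + s ^ 2 * y) ^ j *
        (- (1 / s) - s * q) ^ k * (p / s) ^ l) =
      (\<Sum>\<mu>\<in>?S. \<Sum>a\<le>5. \<Sum>b\<le>5. (\<lambda>\<nu>. ?u \<nu> * y ^ ?ea \<nu> * q ^ ?eb \<nu> * p ^ ?el \<nu> * s ^ ?f \<nu> / s ^ ?g \<nu>) (\<mu>, a, b))"
      by (intro sum.cong refl) (auto simp: expand exponents_def)
    also have "\<dots> = (\<Sum>\<nu>\<in>?A. ?u \<nu> * y ^ ?ea \<nu> * q ^ ?eb \<nu> * p ^ ?el \<nu> * s ^ ?f \<nu> / s ^ ?g \<nu>)"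
      by (simp only: sum.cartesian_product')
    finally show "(\<Sum>(i, j, k, l)\<in>?S. coeff4 D i j k l * (1 / s) ^ i * (1 / s ^ 2 + s ^ 2 * y) ^ j *
        (- (1 / s) - s * q) ^ k * (p / s) ^ l) =
      (\<Sum>\<nu>\<in>?A. ?u \<nu> * y ^ ?ea \<nu> * q ^ ?eb \<nu> * p ^ ?el \<nu> * s ^ ?f \<nu> / s ^ ?g \<nu>)" .
  qed
  then have "(\<Sum>\<nu>\<in>{\<nu>\<in>?A. ?g \<nu> = ?f \<nu> + (M + l - (4 * a + 2 * b)) \<and> ?ea \<nu> = a \<and> ?eb \<nu> = b \<and> ?el \<nu> = l}. ?u \<nu>) = 0"
    by (intro polar_coeffs_vanish3 fin) (use ab in auto)
  also have "{\<nu>\<in>?A. ?g \<nu> = ?f \<nu> + (M + l - (4 * a + 2 * b)) \<and> ?ea \<nu> = a \<and> ?eb \<nu> = b \<and> ?el \<nu> = l} =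
      {((M - 2 * j - k, j, k, l), a, b) | j k. j \<le> 5 \<and> k \<le> 5 \<and> 2 * j + k \<le> M \<and> M - 2 * j - k \<le> 5}"
    (is "?L = ?R")
  proof
    show "?L \<subseteq> ?R" using ab by (auto simp: exponents_def)
    show "?R \<subseteq> ?L" using ab True N by (auto simp: exponents_def weight_def)
  qed
  also have "?R = (\<lambda>(j, k). ((M - 2 * j - k, j, k, l), a, b)) `
      {(j, k) \<in> {..5} \<times> {..5}. 2 * j + k \<le> M \<and> M - 2 * j - k \<le> 5}"
    by auto
  also have "(\<Sum>\<nu>\<in>\<dots>. ?u \<nu>) = (\<Sum>(j, k)\<in>{(j, k) \<in> {..5} \<times> {..5}. 2 * j + k \<le> M \<and> M - 2 * j - k \<le> 5}.
      (-1) ^ k * of_nat (j choose a) * of_nat (k choose b) * coeff4 D (M - 2 * j - k) j k l)"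
    by (subst sum.reindex) (auto simp: inj_on_def intro!: sum.cong)
  also have "\<dots> = (\<Sum>(j, k)\<in>{..5} \<times> {..5}. (-1) ^ k * of_nat (j choose a) * of_nat (k choose b) *
      (if 2 * j + k \<le> M then coeff4 D (M - 2 * j - k) j k l else 0))"
  proof (intro sum.mono_neutral_cong_left)
    have "M - (2 * j + k) \<le> 5" if "coeff4 D (M - (2 * j + k)) j k l \<noteq> 0" for j k
      using deg[OF that] by linarith
    then show "\<forall>\<nu>\<in>{..5} \<times> {..5} - {(j, k) \<in> {..5} \<times> {..5}. 2 * j + k \<le> M \<and> M - 2 * j - k \<le> 5}.
        (case \<nu> of (j, k) \<Rightarrow> (-1) ^ k * of_nat (j choose a) * of_nat (k choose b) *
      (if 2 * j + k \<le> M then coeff4 D (M - 2 * j - k) j k l else 0)) = 0" by (auto split: if_splits)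
  qed auto
  finally show ?thesis by (simp add: sum.cartesian_product')
qed

end

text \<open>
  The uniqueness statement, over any field of characteristic zero.  Downward induction
  on the weight: if all coefficients of weight above \<open>N\<close> vanish, the part of weight \<open>N\<close> satisfies the
  limit conditions of all three charts.  They split it into blocks with \<open>i + 2 j + k = M\<close> and \<open>l\<close> fixed,
  each of which vanishes.  The induction starts at 20, the maximal weight in degree 5.  For \<open>N \<le> 2\<close> the
  correction \<open>e x\<close> could interfere with the third chart, but only \<open>x\<close> and \<open>z\<close> are left there, and the
  first two charts exclude them.
\<close>

lemma rigidity:
  fixes D :: "'a::field_char_0 poly poly poly poly"
  assumes deg: "\<And>i j k l. coeff4 D i j k l \<noteq> 0 \<Longrightarrow> i + j + k + l \<le> 5"
    and ch1: "polynomial_in_chart1 \<alpha>\<^sub>2 D"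
    and ch2: "polynomial_in_chart2 \<alpha>\<^sub>3 D"
    and ch3: "polynomial_in_chart3 \<alpha>\<^sub>1 t e D"
    and yy: "coeff4 D 0 2 0 0 = 0"
  shows "e = 0" and "coeff4 D i j k l \<noteq> 0 \<Longrightarrow> i = 0 \<and> j = 0 \<and> k = 0 \<and> l = 0"
proof -
  have vanish: "coeff4 D i j k l = 0" if "weight (i, j, k, l) > 0" for i j k l
    using that
  proof (induction "20 - weight (i, j, k, l)" arbitrary: i j k l rule: less_induct)
    case (less i j k l)
    define N where "N = weight (i, j, k, l)"
    show ?case
    proof (rule ccontr)
      assume nz: "coeff4 D i j k l \<noteq> 0"
      have le20: "weight (i, j, k, l) \<le> 20" if "coeff4 D i j k l \<noteq> 0" for i j k l
        using deg[OF that] by (simp add: weight_def)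
      have top: "coeff4 D i j k l = 0" if "weight (i, j, k, l) > N" for i j k l
        using less.hyps[of i j k l] that le20[OF nz] le20[of i j k l] by (force simp: N_def)
      have lead1: "coeff4 D i j k l = 0" if "i > 2 * j" "weight (i, j, k, l) = N" for i j k l
        by (rule leading_coeff_chart1[OF _ _ ch1 that]) (use deg top in auto)
      have lead2: "coeff4 D i j k l = 0" if "k > 2 * l" "weight (i, j, k, l) = N" for i j k l
        by (rule leading_coeff_chart2[OF _ _ ch2 that]) (use deg top in auto)
      show False
      proof (cases "N > 2")
        case False
        then have "i > 2 * j \<or> k > 2 * l"
          using less.prems by (auto simp: N_def weight_def)
        then show False using nz lead1[OF _ N_def[symmetric]] lead2[OF _ N_def[symmetric]] by blast
      next
        case True
        define M where "M = i + 2 * j + k"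
        have N: "N = 2 * M + 3 * l" by (simp add: N_def M_def weight_def)
        define c where "c = (\<lambda>j k. if 2 * j + k \<le> M then coeff4 D (M - 2 * j - k) j k l else 0)"
        have E: "(\<Sum>j\<le>5. \<Sum>k\<le>5. (-1) ^ k * of_nat (j choose a) * of_nat (k choose b) * c j k) = 0"
          if "4 * a + 2 * b < M + l" for a b
          unfolding c_def by (rule leading_relations_chart3[OF deg top ch3 True N that])
        have supp: "2 * j + k \<le> M \<and> M \<le> 4 * j + k \<and> k \<le> 2 * l \<and> M + l \<le> 5 + j \<and> j \<le> 5 \<and> k \<le> 5"
          if "c j k \<noteq> 0" for j k
        proof -
          let ?i = "M - 2 * j - k"
          have le: "2 * j + k \<le> M" and nz': "coeff4 D ?i j k l \<noteq> 0"
            using that by (auto simp: c_def split: if_splits)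
          have w: "weight (?i, j, k, l) = N" using le by (simp add: weight_def N)
          have "?i \<le> 2 * j" using lead1[OF _ w] nz' by force
          moreover have "k \<le> 2 * l" using lead2[OF _ w] nz' by force
          moreover note deg[OF nz'] le
          ultimately show ?thesis by linarith
        qed
        have c20: "c 2 0 = 0" if "(M, l) = (4, 0)" using that yy by (simp add: c_def)
        have "c j k = 0"
        proof (cases "(M, l) \<in> {(4, 0), (1, 1), (2, 1), (2, 2), (5, 1), (3, 2)}")
          case exc: True
          show ?thesis by (rule block_vanishes_exceptional[OF supp E exc c20])
        next
          case gen: False
          have pos: "M + l > 0" using True N by linarith
          show ?thesis by (rule block_vanishes_generic[OF supp E pos gen])
        qed
        then show False using nz by (simp add: c_def M_def)
      qed
    qed
  qed
  show const: "i = 0 \<and> j = 0 \<and> k = 0 \<and> l = 0" if "coeff4 D i j k l \<noteq> 0" for i j k l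
  proof -
    have "weight (i, j, k, l) = 0" using vanish that by blast
    then show ?thesis by (simp add: weight_def)
  qed
  have "ev D x y z w = coeff4 D 0 0 0 0" for x y z w
  proof -
    have "ev D x y z w = (\<Sum>(i, j, k, l)\<in>exponents. coeff4 D i j k l * x ^ i * y ^ j * z ^ k * w ^ l)"
      by (rule ev_altdef) (use const in force)
    also have "\<dots> = (\<Sum>(i, j, k, l)\<in>{(0, 0, 0, 0)}. coeff4 D i j k l * x ^ i * y ^ j * z ^ k * w ^ l)"
      using const by (intro sum.mono_neutral_right) (auto simp: exponents_def)
    finally show ?thesis by simp
  qed
  \<comment> \<open>\<open>D\<close> is constant, so the third chart now reads: \<open>e / s\<close> has no pole.\<close>
  then have "regular_at_0 (\<lambda>s. coeff4 D 0 0 0 0 + e / s)"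
    using ch3 unfolding polynomial_in_chart3_def by simp
  then have "regular_at_0 (\<lambda>s. \<Sum>a\<in>{0, 1::nat}. (if a = 0 then coeff4 D 0 0 0 0 else e) * s ^ 0 / s ^ a)"
    by simp
  then have "(\<Sum>a\<in>{a\<in>{0, 1::nat}. a = 0 + 1}. if a = 0 then coeff4 D 0 0 0 0 else e) = 0"
    by (intro polar_coeffs_vanish[where f = "\<lambda>_. 0"]) auto
  moreover have "{a\<in>{0, 1::nat}. a = 0 + 1} = {1}" by auto
  ultimately show "e = 0" by simp
qed

section \<open>Derivations of rational functions\<close>

text \<open>
  Makes the results for fields of characteristic zero applicable to \<open>C(t)\<close>.
\<close>

instance fract :: ("{idom, ring_char_0}") field_char_0
  by standard (simp add: inj_on_def of_nat_fract eq_fract)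

lemma derivation_rules:
  fixes d :: "'b::comm_ring_1 \<Rightarrow> 'b"
  assumes "derivation d"
  shows "d 0 = 0" "d 1 = 0" "d (numeral k) = 0" "d (a + b) = d a + d b"
    "d (a * b) = d a * b + a * d b" "d (- a) = - d a" "d (a - b) = d a - d b"
    "d (a ^ 2) = 2 * a * d a"
proof -
  have add: "d (a + b) = d a + d b" and mult: "d (a * b) = d a * b + a * d b" for a b
    using assms unfolding derivation_def by blast+
  show 0: "d 0 = 0" by (rule derivation_0[OF assms])
  show 1: "d 1 = 0" using mult[of 1 1] by (metis add_cancel_left_right mult_1 mult.comm_neutral)
  have "d (of_nat n) = 0" for n by (induction n) (simp_all add: 0 1 add)
  from this[of "numeral k"] show "d (numeral k) = 0" by simp
  show "d (a + b) = d a + d b" "d (a * b) = d a * b + a * d b" by (rule add mult)+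
  have minus: "d (- a) = - d a" for a
    using add[of a "- a"] 0 by (simp add: eq_neg_iff_add_eq_0 add.commute)
  then show "d (- a) = - d a" .
  show "d (a - b) = d a - d b" using add[of a "- b"] minus by simp
  show "d (a ^ 2) = 2 * a * d a" using mult[of a a] by (simp add: power2_eq_square)
qed

lemma derivation_divide:
  fixes d :: "'b::field \<Rightarrow> 'b"
  assumes "derivation d" "b \<noteq> 0"
  shows "d (a / b) = d a / b - a * d b / b ^ 2"
proof -
  have "d a = d (a / b * b)" using assms(2) by simp
  also have "\<dots> = d (a / b) * b + a / b * d b" by (rule derivation_rules(5)[OF assms(1)])
  finally show ?thesis using assms(2) by (simp add: field_simps power2_eq_square)
qed

lemma fract_deriv_to_fract:
  assumes "derivation d" shows "fract_deriv d (to_fract a) = to_fract (d a)"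
proof -
  have "d 1 = 0" using assms unfolding derivation_def by (metis add_cancel_left_right mult_1 mult.comm_neutral)
  then show ?thesis using fract_deriv_Fract[OF assms, of 1 a] by (simp add: to_fract_def)
qed

lemma derivation_poly_map_poly:
  fixes h :: "'r::{comm_ring_1,semiring_no_zero_divisors} \<Rightarrow> 'b::comm_ring_1"
  assumes d: "derivation d" and h: "is_ring_hom h"
  shows "d (poly (map_poly h p) f) =
    poly (map_poly (\<lambda>c. d (h c)) p) f + poly (map_poly h (pderiv p)) f * d f"
proof (induction p)
  case 0
  show ?case by (simp add: derivation_0[OF d])
next
  case (pCons a p)
  have d_add: "d (u + v) = d u + d v" and d_mult: "d (u * v) = d u * v + u * d v" for u v
    using d unfolding derivation_def by blast+
  note hom = is_ring_homD[OF is_ring_hom_poly_map_poly[OF h, of f]] 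
  show ?case
    using pCons.IH
    by (simp add: map_poly_pCons is_ring_homD[OF h] derivation_0[OF d] d_add d_mult pderiv_pCons
        hom algebra_simps)
qed

lemma poly_map_poly_comp:
  assumes "g 0 = 0" "D 0 = 0"
  shows "poly (map_poly (\<lambda>c. g (D c)) p) b = poly (map_poly g (map_poly D p)) b"
  using map_poly_map_poly[of g D p] assms by (simp add: o_def)

lemma poly_map_poly_mult_right:
  fixes g :: "'r::zero \<Rightarrow> 'b::comm_ring_1"
  assumes "g 0 = 0"
  shows "poly (map_poly (\<lambda>c. g c * k) p) b = poly (map_poly g p) b * k"
  by (induction p) (simp_all add: map_poly_pCons assms algebra_simps)

lemma poly_map_poly_add_fun:
  fixes f g :: "'r::zero \<Rightarrow> 'b::comm_ring_1"
  assumes "f 0 = 0" "g 0 = 0"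
  shows "poly (map_poly (\<lambda>c. f c + g c) p) b = poly (map_poly f p) b + poly (map_poly g p) b"
  by (induction p) (simp_all add: map_poly_pCons assms algebra_simps)

text \<open>
  The chain rule for substitution, for derivations that kill the coefficients.  It is obtained by
  lifting the one-variable rule through the four layers of the polynomial ring.
\<close>

lemma derivation_eval4:
  fixes p :: ct_xyzw
  assumes d: "derivation d" and h: "is_ring_hom h" and dh: "\<And>r. d (h r) = 0"
  shows "d (eval4 h a b c e p) = eval4 h a b c e (pd_x p) * d a + eval4 h a b c e (pd_y p) * d b
    + eval4 h a b c e (pd_z p) * d c + eval4 h a b c e (pd_w p) * d e"
proof -
  define E1 where "E1 = (\<lambda>p. poly (map_poly h p) a)"
  define E2 where "E2 = (\<lambda>p. poly (map_poly E1 p) b)"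
  define E3 where "E3 = (\<lambda>p. poly (map_poly E2 p) c)"
  define E4 where "E4 = (\<lambda>p. poly (map_poly E3 p) e)"
  have E4: "eval4 h a b c e = E4"
    by (simp add: fun_eq_iff eval4_def E1_def E2_def E3_def E4_def)
  have h1: "is_ring_hom E1" unfolding E1_def by (rule is_ring_hom_poly_map_poly[OF h])
  have h2: "is_ring_hom E2" unfolding E2_def by (rule is_ring_hom_poly_map_poly[OF h1])
  have h3: "is_ring_hom E3" unfolding E3_def by (rule is_ring_hom_poly_map_poly[OF h2])
  have h4: "is_ring_hom E4" unfolding E4_def by (rule is_ring_hom_poly_map_poly[OF h3])
  note z = is_ring_homD(1)[OF h] is_ring_homD(1)[OF h1] is_ring_homD(1)[OF h2] is_ring_homD(1)[OF h3]
    is_ring_homD(1)[OF h4]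
  note lift = poly_map_poly_mult_right poly_map_poly_add_fun poly_map_poly_comp
  have zero: "map_poly (\<lambda>c. 0) q = 0" for q :: "'x::zero poly" by (simp add: poly_eq_iff coeff_map_poly)
  have d1: "d (E1 p) = E1 (pderiv p) * d a" for p
    using derivation_poly_map_poly[OF d h, of p a] by (simp add: E1_def dh zero)
  have d2: "d (E2 p) = E2 (map_poly pderiv p) * d a + E2 (pderiv p) * d b" for p
    using derivation_poly_map_poly[OF d h1, of p b]
    unfolding E2_def[symmetric] d1
    by (simp add: E2_def lift z)
  have d3: "d (E3 p) = E3 (map_poly (map_poly pderiv) p) * d a + E3 (map_poly pderiv p) * d b
      + E3 (pderiv p) * d c" for p
    using derivation_poly_map_poly[OF d h2, of p c]
    unfolding E3_def[symmetric] d2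
    by (simp add: E3_def lift z)
  have d4: "d (E4 p) = E4 (map_poly (map_poly (map_poly pderiv)) p) * d a
      + E4 (map_poly (map_poly pderiv) p) * d b + E4 (map_poly pderiv p) * d c
      + E4 (pderiv p) * d e" for p
    using derivation_poly_map_poly[OF d h3, of p e]
    unfolding E4_def[symmetric] d3
    by (simp add: E4_def lift z)
  show ?thesis by (simp add: E4 d4 pd_x_def pd_y_def pd_z_def pd_w_def)
qed

lemma subst_eq_eval4: "subst (a, b, c, d) p = eval4 (\<lambda>r. to_fract (scalar r)) a b c d p"
  by (simp add: subst_def eval4_def)

lemma is_ring_hom_scalar: "is_ring_hom (\<lambda>r. to_fract (scalar r))"
  by (simp add: is_ring_hom_def scalar_def flip: to_fract_add to_fract_mult one_pCons)

lemma pd_scalar: "pd_x (scalar r) = 0" "pd_y (scalar r) = 0" "pd_z (scalar r) = 0" "pd_w (scalar r) = 0"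
  by (simp_all add: pd_x_def pd_y_def pd_z_def pd_w_def scalar_def map_poly_pCons)

lemma pd_generators:
  "pd_x X = 1" "pd_x Y = 0" "pd_x Z = 0" "pd_x W = 0" "pd_x T = 0" "pd_x (const a) = 0"
  "pd_y X = 0" "pd_y Y = 1" "pd_y Z = 0" "pd_y W = 0" "pd_y T = 0" "pd_y (const a) = 0"
  "pd_z X = 0" "pd_z Y = 0" "pd_z Z = 1" "pd_z W = 0" "pd_z T = 0" "pd_z (const a) = 0"
  "pd_w X = 0" "pd_w Y = 0" "pd_w Z = 0" "pd_w W = 1" "pd_w T = 0" "pd_w (const a) = 0"
  "pd_t X = 0" "pd_t Y = 0" "pd_t Z = 0" "pd_t W = 0" "pd_t T = 1" "pd_t (const a) = 0"
proof -
  note D = pd_x_def pd_y_def pd_z_def pd_w_def pd_t_def X_def Y_def Z_def W_def T_def const_def scalar_def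
  have t: "fract_deriv pderiv (0 :: ct) = 0" "fract_deriv pderiv (1 :: ct) = 0"
    using derivation_rules(1,2)[OF derivation_fract_deriv[OF derivation_pderiv]] by auto
  note s = D map_poly_1 map_poly_pCons pderiv_pCons t pCons_one fract_deriv_to_fract[OF derivation_pderiv]
  show "pd_x X = 1" "pd_x Y = 0" "pd_x Z = 0" "pd_x W = 0" "pd_x T = 0" "pd_x (const a) = 0"
  "pd_y X = 0" "pd_y Y = 1" "pd_y Z = 0" "pd_y W = 0" "pd_y T = 0" "pd_y (const a) = 0"
  "pd_z X = 0" "pd_z Y = 0" "pd_z Z = 1" "pd_z W = 0" "pd_z T = 0" "pd_z (const a) = 0"
  "pd_w X = 0" "pd_w Y = 0" "pd_w Z = 0" "pd_w W = 1" "pd_w T = 0" "pd_w (const a) = 0"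
  "pd_t X = 0" "pd_t Y = 0" "pd_t Z = 0" "pd_t W = 0" "pd_t T = 1" "pd_t (const a) = 0"
    by (simp_all add: s)
qed

section \<open>Values and poles of rational functions\<close>

text \<open>
  Partial evaluation of rational functions at a point.  A relation avoids choosing a reduced
  representation: any denominator that does not vanish at the point may be used.
\<close>

definition has_value :: "ct_xyzw_frac \<Rightarrow> ct \<Rightarrow> ct \<Rightarrow> ct \<Rightarrow> ct \<Rightarrow> ct \<Rightarrow> bool" where
  "has_value f x y z w v \<longleftrightarrow> (\<exists>N D. f * to_fract D = to_fract N \<and>
     ev D x y z w \<noteq> 0 \<and> v * ev D x y z w = ev N x y z w)"

lemma has_value_unique:
  assumes "has_value (to_fract P) x y z w v" shows "v = ev P x y z w"
proof -
  obtain N D where *: "to_fract P * to_fract D = to_fract N" "ev D x y z w \<noteq> 0"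
    "v * ev D x y z w = ev N x y z w"
    using assms unfolding has_value_def by blast
  then have "P * D = N" by (simp flip: to_fract_mult)
  then have "ev P x y z w * ev D x y z w = v * ev D x y z w"
    using *(3) by (simp add: ev_simps flip: ev_simps(4))
  then show ?thesis using *(2) by simp
qed

lemma has_value_to_fract: "has_value (to_fract P) x y z w (ev P x y z w)"
  unfolding has_value_def by (intro exI[of _ P] exI[of _ 1]) (simp add: ev_simps)

lemma has_value_zero: "has_value 0 x y z w 0"
  using has_value_to_fract[of 0] by (simp add: ev_simps)

lemma has_value_add:
  assumes "has_value f x y z w u" "has_value g x y z w v" shows "has_value (f + g) x y z w (u + v)"
proof -
  obtain N D where f: "f * to_fract D = to_fract N" "ev D x y z w \<noteq> 0" "u * ev D x y z w = ev N x y z w"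
    using assms(1) unfolding has_value_def by blast
  obtain M E where g: "g * to_fract E = to_fract M" "ev E x y z w \<noteq> 0" "v * ev E x y z w = ev M x y z w"
    using assms(2) unfolding has_value_def by blast
  show ?thesis unfolding has_value_def
    by (intro exI[of _ "N * E + M * D"] exI[of _ "D * E"])
       (simp add: ev_simps f(2) g(2) flip: f(1,3) g(1,3), simp add: algebra_simps)
qed

lemma has_value_mult:
  assumes "has_value f x y z w u" "has_value g x y z w v" shows "has_value (f * g) x y z w (u * v)"
proof -
  obtain N D where f: "f * to_fract D = to_fract N" "ev D x y z w \<noteq> 0" "u * ev D x y z w = ev N x y z w"
    using assms(1) unfolding has_value_def by blast
  obtain M E where g: "g * to_fract E = to_fract M" "ev E x y z w \<noteq> 0" "v * ev E x y z w = ev M x y z w"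
    using assms(2) unfolding has_value_def by blast
  show ?thesis unfolding has_value_def
    by (intro exI[of _ "N * M"] exI[of _ "D * E"])
       (simp add: ev_simps f(2) g(2) flip: f(1,3) g(1,3))
qed

lemma has_value_uminus:
  assumes "has_value f x y z w u" shows "has_value (- f) x y z w (- u)"
  using has_value_mult[OF has_value_to_fract[of "- 1"] assms] by (simp add: ev_simps)

lemma has_value_divide:
  assumes "has_value f x y z w u" "has_value g x y z w v" "v \<noteq> 0"
  shows "has_value (f / g) x y z w (u / v)"
proof -
  obtain M E where g: "g * to_fract E = to_fract M" "ev E x y z w \<noteq> 0" "v * ev E x y z w = ev M x y z w"
    using assms(2) unfolding has_value_def by blast
  have M: "ev M x y z w \<noteq> 0" using g(2,3) assms(3) by (metis mult_eq_0_iff)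
  then have "M \<noteq> 0" by (auto simp: ev_simps)
  then have "g \<noteq> 0" using g(1) by auto
  then have "(1 / g) * to_fract M = to_fract E" using g(1) by (simp add: field_simps)
  moreover have "(1 / v) * ev M x y z w = ev E x y z w" using g(3) assms(3) by (simp add: field_simps)
  ultimately have "has_value (1 / g) x y z w (1 / v)" using M unfolding has_value_def by blast
  from has_value_mult[OF assms(1) this] show ?thesis by simp
qed

lemma has_value_poly_map_poly:
  assumes "\<And>c. has_value (h c) x y z w (e c)" "has_value f x y z w v" "h 0 = 0" "e 0 = 0"
  shows "has_value (poly (map_poly h p) f) x y z w (poly (map_poly e p) v)"
  by (induction p) (auto simp: map_poly_pCons assms(3,4)
    intro!: has_value_zero has_value_add has_value_mult assms(1,2))

lemma ev_scalar: "ev (scalar r) x y z w = r"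
  by (simp add: eval4_def scalar_def map_poly_pCons)

lemma has_value_subst:
  assumes "has_value a x y z w u1" "has_value b x y z w u2" "has_value c x y z w u3" "has_value d x y z w u4"
  shows "has_value (subst (a, b, c, d) G) x y z w (ev G u1 u2 u3 u4)"
proof -
  have 0: "to_fract (scalar 0) = 0" by (simp add: scalar_def)
  have s: "has_value (to_fract (scalar r)) x y z w r" for r
    using has_value_to_fract[of "scalar r" x y z w] by (simp add: ev_scalar)
  show ?thesis
    unfolding subst_eq_eval4 eval4_def
    by (intro has_value_poly_map_poly assms s) (simp_all add: 0)
qed

lemma ev_generators [simp]:
  "ev X x y z w = x" "ev Y x y z w = y" "ev Z x y z w = z" "ev W x y z w = w"
  "ev T x y z w = to_fract [:0, 1:]" "ev (const a) x y z w = to_fract [:a:]"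
  by (simp_all add: eval4_def X_def Y_def Z_def W_def T_def const_def scalar_def map_poly_pCons)

lemma regular_at_0_poly_map_poly:
  assumes "\<And>c. regular_at_0 (\<lambda>s. h s c)" "regular_at_0 f" "\<And>s. h s 0 = 0"
  shows "regular_at_0 (\<lambda>s. poly (map_poly (h s) p) (f s))"
  by (induction p) (auto simp: map_poly_pCons assms(3)
    intro!: regular_at_0_const regular_at_0_add regular_at_0_mult assms(1,2))

lemma regular_at_0_ev:
  assumes "regular_at_0 a" "regular_at_0 b" "regular_at_0 c" "regular_at_0 d"
  shows "regular_at_0 (\<lambda>s. ev G (a s) (b s) (c s) (d s))"
  unfolding eval4_def
  by (intro regular_at_0_poly_map_poly assms regular_at_0_const) simp_all

text \<open>
  The new coordinates of a chart have only powers of \<open>X\<close>, or only powers of \<open>Z\<close>, as denominators,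
  and so have polynomials in them.  This makes the integration below elementary.
\<close>

definition poles_along :: "ct_xyzw \<Rightarrow> ct_xyzw_frac \<Rightarrow> bool" where
  "poles_along V f \<longleftrightarrow> (\<exists>n N. to_fract V ^ n * f = to_fract N)"

lemma to_fract_power: "to_fract (a ^ n) = to_fract a ^ n"
  by (induction n) simp_all

lemma poles_along_to_fract: "poles_along V (to_fract P)"
  unfolding poles_along_def by (intro exI[of _ 0] exI[of _ P]) simp

lemma poles_along_inverse: "V \<noteq> 0 \<Longrightarrow> poles_along V (1 / to_fract V)"
  unfolding poles_along_def by (intro exI[of _ 1]) simp

lemma poles_along_add:
  assumes "poles_along V f" "poles_along V g" shows "poles_along V (f + g)"
proof -
  obtain n N m M where f: "to_fract V ^ n * f = to_fract N" and g: "to_fract V ^ m * g = to_fract M"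
    using assms unfolding poles_along_def by blast
  have "to_fract V ^ (n + m) * (f + g) = to_fract (V ^ m * N + V ^ n * M)"
    by (simp add: to_fract_power power_add algebra_simps flip: f g)
  then show ?thesis unfolding poles_along_def by blast
qed

lemma poles_along_mult:
  assumes "poles_along V f" "poles_along V g" shows "poles_along V (f * g)"
proof -
  obtain n N m M where f: "to_fract V ^ n * f = to_fract N" and g: "to_fract V ^ m * g = to_fract M"
    using assms unfolding poles_along_def by blast
  have "to_fract V ^ (n + m) * (f * g) = to_fract (N * M)"
    by (simp add: power_add algebra_simps flip: f g)
  then show ?thesis unfolding poles_along_def by blast
qed

lemma poles_along_uminus: "poles_along V f \<Longrightarrow> poles_along V (- f)"
  using poles_along_mult[OF poles_along_to_fract[of V "- 1"]] by simp

lemma poles_along_diff: "poles_along V f \<Longrightarrow> poles_along V g \<Longrightarrow> poles_along V (f - g)"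
  using poles_along_add[OF _ poles_along_uminus] by simp

lemma poles_along_poly_map_poly:
  assumes "\<And>c. poles_along V (h c)" "poles_along V f" "h 0 = 0"
  shows "poles_along V (poly (map_poly h p) f)"
  using poles_along_to_fract[of V 0]
  by (induction p) (auto simp: map_poly_pCons assms(3)
    intro!: poles_along_add poles_along_mult assms(1,2))

lemma poles_along_subst:
  assumes "poles_along V a" "poles_along V b" "poles_along V c" "poles_along V d"
  shows "poles_along V (subst (a, b, c, d) G)"
proof -
  have 0: "to_fract (scalar 0) = 0" by (simp add: scalar_def)
  show ?thesis
    unfolding subst_eq_eval4 eval4_def
    by (intro poles_along_poly_map_poly assms poles_along_to_fract) (simp_all add: 0)
qed

lemma coeff4_pd:
  "coeff4 (pd_x P) i j k l = of_nat (Suc i) * coeff4 P (Suc i) j k l"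
  "coeff4 (pd_y P) i j k l = of_nat (Suc j) * coeff4 P i (Suc j) k l"
  "coeff4 (pd_z P) i j k l = of_nat (Suc k) * coeff4 P i j (Suc k) l"
  "coeff4 (pd_w P) i j k l = of_nat (Suc l) * coeff4 P i j k (Suc l)"
  by (simp_all add: coeff4_def pd_x_def pd_y_def pd_z_def pd_w_def coeff_map_poly coeff_pderiv
      of_nat_poly del: of_nat_Suc)

lemma coeff4_mult_generators:
  "coeff4 (X * P) i j k l = (case i of 0 \<Rightarrow> 0 | Suc i \<Rightarrow> coeff4 P i j k l)"
  "coeff4 (Z * P) i j k l = (case k of 0 \<Rightarrow> 0 | Suc k \<Rightarrow> coeff4 P i j k l)"
  by (simp_all add: coeff4_def X_def Z_def coeff_pCons split: nat.splits)

lemma coeff4_scalar: "coeff4 (scalar r) i j k l = (if i = 0 \<and> j = 0 \<and> k = 0 \<and> l = 0 then r else 0)"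
  by (simp add: coeff4_def scalar_def coeff_pCons split: nat.splits)

lemma coeff4_monomial:
  "coeff4 (X ^ n * scalar r) i j k l = (if i = n \<and> j = 0 \<and> k = 0 \<and> l = 0 then r else 0)"
  "coeff4 (Z ^ n * scalar r) i j k l = (if i = 0 \<and> j = 0 \<and> k = n \<and> l = 0 then r else 0)"
proof -
  show "coeff4 (X ^ n * scalar r) i j k l = (if i = n \<and> j = 0 \<and> k = 0 \<and> l = 0 then r else 0)"
  proof (induction n arbitrary: i)
    case (Suc n)
    then show ?case by (cases i) (simp_all add: coeff4_mult_generators mult.assoc)
  qed (simp add: coeff4_scalar)
  show "coeff4 (Z ^ n * scalar r) i j k l = (if i = 0 \<and> j = 0 \<and> k = n \<and> l = 0 then r else 0)"
  proof (induction n arbitrary: k)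
    case (Suc n)
    then show ?case by (cases k) (simp_all add: coeff4_mult_generators mult.assoc)
  qed (simp add: coeff4_scalar)
qed

lemma coeff4_of_nat_mult: "coeff4 (of_nat n * P) i j k l = of_nat n * coeff4 P i j k l"
  by (simp add: coeff4_def of_nat_poly)

section \<open>The Hamiltonian in canonical coordinates\<close>

lemmas derivations = derivation_pd[THEN derivation_fract_deriv]

text \<open>
  Write \<open>f = N / V ^ n\<close>.  Vanishing derivatives make \<open>N\<close> free of the three other variables and
  give Euler's relation \<open>V \<partial>N/\<partial>V = n N\<close>, so in characteristic zero \<open>N\<close> is a multiple of \<open>V ^ n\<close>.
\<close>

lemma constant_of_zero_derivatives:
  assumes pol: "poles_along V f" and V: "V = X \<or> V = Z"
    and x: "fract_deriv pd_x f = 0" and y: "fract_deriv pd_y f = 0"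
    and z: "fract_deriv pd_z f = 0" and w: "fract_deriv pd_w f = 0"
  shows "\<exists>\<kappa>. f = to_fract (scalar \<kappa>)"
proof -
  obtain n N where N: "to_fract V ^ n * f = to_fract N"
    using pol unfolding poles_along_def by blast
  have V0: "V \<noteq> 0" using V by (auto simp: X_def Z_def)
  have key: "V * d N = of_nat n * (d V * N)" if "derivation d" "fract_deriv d f = 0" for d
  proof -
    note D = derivation_fract_deriv[OF that(1)]
    have pow: "to_fract V * fract_deriv d (to_fract V ^ n) =
        of_nat n * (to_fract (d V) * to_fract V ^ n)" for n
      by (induction n)
         (simp_all add: derivation_rules[OF D] fract_deriv_to_fract[OF that(1)] algebra_simps)
    have "fract_deriv d (to_fract N) = fract_deriv d (to_fract V ^ n) * f"
      by (simp add: derivation_rules[OF D] that(2) flip: N)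
    then have "to_fract V * to_fract (d N) = of_nat n * (to_fract (d V) * to_fract V ^ n) * f"
      using pow[of n] by (simp add: fract_deriv_to_fract[OF that(1)] flip: mult.assoc)
    also have "\<dots> = of_nat n * to_fract (d V) * to_fract N"
      by (simp add: flip: N)
    also have "of_nat n = to_fract (of_nat n :: ct_xyzw)"
      by (induction n) simp_all
    finally have "to_fract (V * d N) = to_fract (of_nat n * (d V * N))"
      by (simp add: mult.assoc)
    then show ?thesis by (simp only: to_fract_eq_iff)
  qed
  note eqs = key[OF derivation_pd(1) x] key[OF derivation_pd(2) y] key[OF derivation_pd(3) z]
    key[OF derivation_pd(4) w]
  from V show ?thesis
  proof
    assume [simp]: "V = X"
    have 1: "pd_y N = 0" "pd_z N = 0" "pd_w N = 0"
      using eqs(2-4) V0 by (simp_all add: pd_generators)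
    have 2: "X * pd_x N = of_nat n * N"
      using eqs(1) by (simp add: pd_generators)
    have "N = X ^ n * scalar (coeff4 N n 0 0 0)"
    proof (rule coeff4_eqI)
      fix i j k l
      have "coeff4 N i j k l = 0" if "j \<noteq> 0"
        using arg_cong[OF 1(1), of "\<lambda>P. coeff4 P i (j - 1) k l"] that
        by (simp add: coeff4_pd coeff4_def[of 0] del: of_nat_Suc)
      moreover have "coeff4 N i j k l = 0" if "k \<noteq> 0"
        using arg_cong[OF 1(2), of "\<lambda>P. coeff4 P i j (k - 1) l"] that
        by (simp add: coeff4_pd coeff4_def[of 0] del: of_nat_Suc)
      moreover have "coeff4 N i j k l = 0" if "l \<noteq> 0"
        using arg_cong[OF 1(3), of "\<lambda>P. coeff4 P i j k (l - 1)"] that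
        by (simp add: coeff4_pd coeff4_def[of 0] del: of_nat_Suc)
      moreover have "coeff4 N i j k l = 0" if "i \<noteq> n"
        using arg_cong[OF 2, of "\<lambda>P. coeff4 P i j k l"] that
        by (cases i) (simp_all add: coeff4_pd coeff4_mult_generators coeff4_of_nat_mult del: of_nat_Suc)
      ultimately show "coeff4 N i j k l = coeff4 (X ^ n * scalar (coeff4 N n 0 0 0)) i j k l"
        by (auto simp: coeff4_monomial)
    qed
    then have "to_fract X ^ n * f = to_fract X ^ n * to_fract (scalar (coeff4 N n 0 0 0))"
      using N by (simp flip: to_fract_power to_fract_mult)
    then show ?thesis using V0 by auto
  next
    assume [simp]: "V = Z"
    have 1: "pd_x N = 0" "pd_y N = 0" "pd_w N = 0"
      using eqs(1,2,4) V0 by (simp_all add: pd_generators)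
    have 2: "Z * pd_z N = of_nat n * N"
      using eqs(3) by (simp add: pd_generators)
    have "N = Z ^ n * scalar (coeff4 N 0 0 n 0)"
    proof (rule coeff4_eqI)
      fix i j k l
      have "coeff4 N i j k l = 0" if "i \<noteq> 0"
        using arg_cong[OF 1(1), of "\<lambda>P. coeff4 P (i - 1) j k l"] that
        by (simp add: coeff4_pd coeff4_def[of 0] del: of_nat_Suc)
      moreover have "coeff4 N i j k l = 0" if "j \<noteq> 0"
        using arg_cong[OF 1(2), of "\<lambda>P. coeff4 P i (j - 1) k l"] that
        by (simp add: coeff4_pd coeff4_def[of 0] del: of_nat_Suc)
      moreover have "coeff4 N i j k l = 0" if "l \<noteq> 0"
        using arg_cong[OF 1(3), of "\<lambda>P. coeff4 P i j k (l - 1)"] that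
        by (simp add: coeff4_pd coeff4_def[of 0] del: of_nat_Suc)
      moreover have "coeff4 N i j k l = 0" if "k \<noteq> n"
        using arg_cong[OF 2, of "\<lambda>P. coeff4 P i j k l"] that
        by (cases k) (simp_all add: coeff4_pd coeff4_mult_generators coeff4_of_nat_mult del: of_nat_Suc)
      ultimately show "coeff4 N i j k l = coeff4 (Z ^ n * scalar (coeff4 N 0 0 n 0)) i j k l"
        by (auto simp: coeff4_monomial)
    qed
    then have "to_fract Z ^ n * f = to_fract Z ^ n * to_fract (scalar (coeff4 N 0 0 n 0))"
      using N by (simp flip: to_fract_power to_fract_mult)
    then show ?thesis using V0 by auto
  qed
qed

text \<open>
  The hypothesis \<open>symp\<close> expresses that the coordinate change is canonical; \<open>C\<close> compensates for its
  explicit dependence on \<open>t\<close>.  By the chain rule its left-hand side is the derivative of the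
  transformed Hamiltonian \<open>G\<close>, so that \<open>G\<close> and \<open>H + C\<close> have equal partial derivatives
  in the old coordinates and differ by an element of \<open>C(t)\<close>.
\<close>

lemma hamiltonian_up_to_constant:
  assumes bec: "becomes_polynomial_hamiltonian (hamiltonian_system H) (xi, yi, zi, wi)"
    and V: "V = X \<or> V = Z"
    and pol: "poles_along V xi" "poles_along V yi" "poles_along V zi" "poles_along V wi"
    and symp: "\<And>d. d \<in> {pd_x, pd_y, pd_z, pd_w} \<Longrightarrow>
      - time_deriv (hamiltonian_system H) yi * fract_deriv d xi
      + time_deriv (hamiltonian_system H) xi * fract_deriv d yi
      - time_deriv (hamiltonian_system H) wi * fract_deriv d zi
      + time_deriv (hamiltonian_system H) zi * fract_deriv d wi = to_fract (d (H + C))"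
  shows "\<exists>G \<kappa>. subst (xi, yi, zi, wi) G = to_fract (H + C + scalar \<kappa>)"
proof -
  let ?v = "hamiltonian_system H" and ?s = "subst (xi, yi, zi, wi)"
  obtain G where G: "time_deriv ?v xi = ?s (pd_y G)" "time_deriv ?v yi = - ?s (pd_x G)"
    "time_deriv ?v zi = ?s (pd_w G)" "time_deriv ?v wi = - ?s (pd_z G)"
    using bec unfolding becomes_polynomial_hamiltonian_def by auto
  have zero: "fract_deriv d (?s G - to_fract (H + C)) = 0"
    if d: "d \<in> {pd_x, pd_y, pd_z, pd_w}" for d
  proof -
    have der: "derivation d" using d derivation_pd by auto
    have ds: "fract_deriv d (to_fract (scalar r)) = 0" for r
      using d by (auto simp: fract_deriv_to_fract[OF der] pd_scalar)
    have "fract_deriv d (?s G) = ?s (pd_x G) * fract_deriv d xi + ?s (pd_y G) * fract_deriv d yi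
        + ?s (pd_z G) * fract_deriv d zi + ?s (pd_w G) * fract_deriv d wi"
      unfolding subst_eq_eval4
      by (rule derivation_eval4[OF derivation_fract_deriv[OF der] is_ring_hom_scalar ds])
    then have "fract_deriv d (?s G) = to_fract (d (H + C))"
      using symp[OF d] by (simp add: G)
    then show ?thesis
      by (simp only: derivation_rules[OF derivation_fract_deriv[OF der]] fract_deriv_to_fract[OF der]) simp
  qed
  have "\<exists>\<kappa>. ?s G - to_fract (H + C) = to_fract (scalar \<kappa>)"
    by (rule constant_of_zero_derivatives[OF _ V])
       (intro zero poles_along_diff poles_along_subst pol poles_along_to_fract; simp)+
  then obtain \<kappa> where "?s G - to_fract (H + C) = to_fract (scalar \<kappa>)" by blast
  then have "?s G = to_fract (H + C + scalar \<kappa>)" by (simp add: algebra_simps)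
  then show ?thesis by blast
qed

lemmas time_deriv_rules = time_deriv_def hamiltonian_system_def pd_generators
  derivations[THEN derivation_rules(1)] derivations[THEN derivation_rules(2)]
  derivations[THEN derivation_rules(3)] derivations[THEN derivation_rules(4)]
  derivations[THEN derivation_rules(5)] derivations[THEN derivation_rules(6)]
  derivations[THEN derivation_rules(7)] derivations[THEN derivation_rules(8)]
  derivations[THEN derivation_divide] derivation_pd[THEN fract_deriv_to_fract]

lemma generators_nonzero: "X \<noteq> 0" "Z \<noteq> 0"
  by (simp_all add: X_def Z_def)

lemma pd_add:
  "pd_x (P + Q) = pd_x P + pd_x Q" "pd_y (P + Q) = pd_y P + pd_y Q"
  "pd_z (P + Q) = pd_z P + pd_z Q" "pd_w (P + Q) = pd_w P + pd_w Q"
  using derivation_pd unfolding derivation_def by blast+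

lemma chart1_hamiltonian:
  assumes "becomes_polynomial_hamiltonian (hamiltonian_system H) (coords1 \<alpha>\<^sub>2)"
  shows "\<exists>G \<kappa>. subst (coords1 \<alpha>\<^sub>2) G = to_fract (H + scalar \<kappa>)"
proof -
  note bec = assms[unfolded coords1_def Let_def]
  have "\<exists>G \<kappa>. subst (coords1 \<alpha>\<^sub>2) G = to_fract (H + 0 + scalar \<kappa>)"
    unfolding coords1_def Let_def
  proof (rule hamiltonian_up_to_constant[OF bec, where V = X], goal_cases)
    case (6 d)
    then show ?case using generators_nonzero
      by (auto simp: time_deriv_rules field_simps power2_eq_square)
  qed (auto simp: generators_nonzero intro!: poles_along_mult poles_along_add poles_along_diff poles_along_uminus poles_along_inverse
      poles_along_to_fract)
  then show ?thesis by simp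
qed

lemma chart2_hamiltonian:
  assumes "becomes_polynomial_hamiltonian (hamiltonian_system H) (coords2 \<alpha>\<^sub>3)"
  shows "\<exists>G \<kappa>. subst (coords2 \<alpha>\<^sub>3) G = to_fract (H + scalar \<kappa>)"
proof -
  note bec = assms[unfolded coords2_def Let_def]
  have "\<exists>G \<kappa>. subst (coords2 \<alpha>\<^sub>3) G = to_fract (H + 0 + scalar \<kappa>)"
    unfolding coords2_def Let_def
  proof (rule hamiltonian_up_to_constant[OF bec, where V = Z], goal_cases)
    case (6 d)
    then show ?case using generators_nonzero
      by (auto simp: time_deriv_rules field_simps power2_eq_square)
  qed (auto simp: generators_nonzero intro!: poles_along_mult poles_along_add poles_along_diff poles_along_uminus poles_along_inverse
      poles_along_to_fract)
  then show ?thesis by simp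
qed

text \<open>
  Here \<open>\<partial>y\<^sub>3/\<partial>t = x\<^sup>2 = 1 / x\<^sub>3\<^sup>2\<close>, and \<open>- \<partial>G/\<partial>x\<^sub>3\<close> accounts for it if \<open>G\<close> contains \<open>1 / x\<^sub>3 = x\<close>.
\<close>

lemma chart3_hamiltonian:
  assumes "becomes_polynomial_hamiltonian (hamiltonian_system H) (coords3 \<alpha>\<^sub>1)"
  shows "\<exists>G \<kappa>. subst (coords3 \<alpha>\<^sub>1) G = to_fract (H + X + scalar \<kappa>)"
proof -
  note bec = assms[unfolded coords3_def Let_def]
  show ?thesis
    unfolding coords3_def Let_def
  proof (rule hamiltonian_up_to_constant[OF bec, where V = X], goal_cases)
    case (6 d)
    then show ?case using generators_nonzero
      by (auto simp: time_deriv_rules pd_add field_simps power2_eq_square)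
  next
    case 4
    have "poles_along X (to_fract W * (1 / to_fract X))"
      by (intro poles_along_mult poles_along_inverse generators_nonzero poles_along_to_fract)
    then show ?case using poles_along_uminus by simp
  qed (auto simp: generators_nonzero power2_eq_square intro!: poles_along_mult poles_along_add poles_along_diff poles_along_uminus poles_along_inverse
      poles_along_to_fract)
qed

section \<open>Uniqueness of the Hamiltonian\<close>

text \<open>
  Evaluate \<open>G(x\<^sub>i, y\<^sub>i, z\<^sub>i, w\<^sub>i) = H + \<kappa>\<close> at the points of the curve on which the new coordinates are
  \<open>s\<close> and prescribed constants: the left-hand side is then polynomial in \<open>s\<close>.
\<close>

lemma polynomial_in_chart1_of_subst:
  assumes "subst (coords1 \<alpha>) G = to_fract (H + scalar \<kappa>)"
  shows "polynomial_in_chart1 (to_fract [:\<alpha>:]) H"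
  unfolding polynomial_in_chart1_def
proof (intro allI)
  fix y z w
  let ?a = "to_fract [:\<alpha>:]"
  have "regular_at_0 (\<lambda>s. ev G s (- y) z w + (- \<kappa>))"
    by (intro regular_at_0_add regular_at_0_ev regular_at_0_const regular_at_0_ident)
  then show "regular_at_0 (\<lambda>s. ev H (1 / s) (s ^ 2 * y - ?a * s) z w)"
  proof (rule regular_at_0_cong)
    fix s :: ct assume s: "s \<noteq> 0"
    let ?y = "s ^ 2 * y - ?a * s"
    let ?hv = "\<lambda>f v. has_value f (1 / s) ?y z w v"
    have gen: "?hv (to_fract P) (ev P (1 / s) ?y z w)" for P by (rule has_value_to_fract)
    have 1: "?hv (1 / to_fract X) s"
      using has_value_divide[OF gen[of 1] gen[of X]] s by (simp add: ev_simps)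
    have 2: "?hv (- to_fract X * (to_fract X * to_fract Y + to_fract (const \<alpha>))) (- y)"
      using gen[of "- X * (X * Y + const \<alpha>)"] s
      by (simp add: ev_simps field_simps power2_eq_square)
    have "?hv (subst (coords1 \<alpha>) G) (ev G s (- y) z w)"
      unfolding coords1_def Let_def
      using has_value_subst[OF 1 2 gen[of Z] gen[of W]] by simp
    from has_value_unique[OF this[unfolded assms]]
    show "ev G s (- y) z w + (- \<kappa>) = ev H (1 / s) ?y z w" by (simp add: ev_simps ev_scalar)
  qed
qed

lemma polynomial_in_chart2_of_subst:
  assumes "subst (coords2 \<alpha>) G = to_fract (H + scalar \<kappa>)"
  shows "polynomial_in_chart2 (to_fract [:\<alpha>:]) H"
  unfolding polynomial_in_chart2_def
proof (intro allI)
  fix x y w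
  let ?a = "to_fract [:\<alpha>:]"
  have "regular_at_0 (\<lambda>s. ev G x y s (- w) + (- \<kappa>))"
    by (intro regular_at_0_add regular_at_0_ev regular_at_0_const regular_at_0_ident)
  then show "regular_at_0 (\<lambda>s. ev H x y (1 / s) (s ^ 2 * w - ?a * s))"
  proof (rule regular_at_0_cong)
    fix s :: ct assume s: "s \<noteq> 0"
    let ?w = "s ^ 2 * w - ?a * s"
    let ?hv = "\<lambda>f v. has_value f x y (1 / s) ?w v"
    have gen: "?hv (to_fract P) (ev P x y (1 / s) ?w)" for P by (rule has_value_to_fract)
    have 3: "?hv (1 / to_fract Z) s"
      using has_value_divide[OF gen[of 1] gen[of Z]] s by (simp add: ev_simps)
    have 4: "?hv (- (to_fract Z * to_fract W + to_fract (const \<alpha>)) * to_fract Z) (- w)"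
      using gen[of "- (Z * W + const \<alpha>) * Z"] s
      by (simp add: ev_simps field_simps power2_eq_square)
    have "?hv (subst (coords2 \<alpha>) G) (ev G x y s (- w))"
      unfolding coords2_def Let_def
      using has_value_subst[OF gen[of X] gen[of Y] 3 4] by simp
    from has_value_unique[OF this[unfolded assms]]
    show "ev G x y s (- w) + (- \<kappa>) = ev H x y (1 / s) ?w" by (simp add: ev_simps ev_scalar)
  qed
qed

lemma polynomial_in_chart3_of_subst:
  assumes "subst (coords3 \<alpha>) G = to_fract (H + X + scalar \<kappa>)"
  shows "polynomial_in_chart3 (to_fract [:\<alpha>:]) (to_fract [:0, 1:]) 1 H"
  unfolding polynomial_in_chart3_def
proof (intro allI)
  fix y p q
  let ?a = "to_fract [:\<alpha>:]" and ?t = "to_fract [:0, 1:]"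
  have "regular_at_0 (\<lambda>s. ev G s (- y) (- p) (- q) + (- \<kappa>))"
    by (intro regular_at_0_add regular_at_0_ev regular_at_0_const regular_at_0_ident)
  then show "regular_at_0 (\<lambda>s. ev H (1 / s) (1 / s ^ 2 + p / s + ?t - s * (p * q + ?a) + s ^ 2 * y)
      (- (1 / s) - s * q) (p / s) + 1 / s)"
  proof (rule regular_at_0_cong)
    fix s :: ct assume s: "s \<noteq> 0"
    let ?y = "1 / s ^ 2 + p / s + ?t - s * (p * q + ?a) + s ^ 2 * y" and ?z = "- (1 / s) - s * q"
    let ?hv = "\<lambda>f v. has_value f (1 / s) ?y ?z (p / s) v"
    have gen: "?hv (to_fract P) (ev P (1 / s) ?y ?z (p / s))" for P by (rule has_value_to_fract)
    have 1: "?hv (1 / to_fract X) s"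
      using has_value_divide[OF gen[of 1] gen[of X]] s by (simp add: ev_simps)
    have "ev (- ((Y - X ^ 2 - W - T) * X - (X + Z) * W + const \<alpha>) * X) (1 / s) ?y ?z (p / s) = - y"
      using s by (simp add: ev_simps field_simps power2_eq_square)
    then have 2: "?hv (- ((to_fract Y - to_fract X ^ 2 - to_fract W - to_fract T) * to_fract X
        - (to_fract X + to_fract Z) * to_fract W + to_fract (const \<alpha>)) * to_fract X) (- y)"
      using gen[of "- ((Y - X ^ 2 - W - T) * X - (X + Z) * W + const \<alpha>) * X"]
      by (simp only: to_fract_power to_fract_mult to_fract_add to_fract_diff to_fract_uminus)
    have 3: "?hv (- (to_fract W / to_fract X)) (- p)"
      using has_value_uminus[OF has_value_divide[OF gen[of W] gen[of X]]] s by simp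
    have 4: "?hv (to_fract X * (to_fract X + to_fract Z)) (- q)"
      using gen[of "X * (X + Z)"] s by (simp add: ev_simps)
    have "?hv (subst (coords3 \<alpha>) G) (ev G s (- y) (- p) (- q))"
      unfolding coords3_def Let_def by (rule has_value_subst[OF 1 2 3 4])
    from has_value_unique[OF this[unfolded assms]]
    show "ev G s (- y) (- p) (- q) + (- \<kappa>) = ev H (1 / s) ?y ?z (p / s) + 1 / s"
      by (simp add: ev_simps ev_scalar)
  qed
qed

definition reference_hamiltonian :: "complex \<Rightarrow> complex \<Rightarrow> ct_xyzw" where
  "reference_hamiltonian \<alpha>\<^sub>2 \<alpha>\<^sub>3 = - 2 * X^2 * Y + 2 * Y^2 - 2 * T * Y - 2 * const \<alpha>\<^sub>2 * X
       + Z^2 * W + W^2 + T * W + const \<alpha>\<^sub>3 * Z - 3 * Y * W"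

lemma ev_reference_hamiltonian: "ev (reference_hamiltonian \<alpha>\<^sub>2 \<alpha>\<^sub>3) x y z w =
   - 2 * x^2 * y + 2 * y^2 - 2 * to_fract [:0, 1:] * y - 2 * to_fract [:\<alpha>\<^sub>2:] * x
       + z^2 * w + w^2 + to_fract [:0, 1:] * w + to_fract [:\<alpha>\<^sub>3:] * z - 3 * y * w"
  by (simp add: reference_hamiltonian_def ev_simps)

lemma reference_hamiltonian_chart1: "polynomial_in_chart1 (to_fract [:\<alpha>\<^sub>2:]) (reference_hamiltonian \<alpha>\<^sub>2 \<alpha>\<^sub>3)"
  unfolding polynomial_in_chart1_def
proof (intro allI)
  fix y z w
  let ?t = "to_fract [:0, 1:]" and ?a2 = "to_fract [:\<alpha>\<^sub>2:]" and ?a3 = "to_fract [:\<alpha>\<^sub>3:]"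
  let ?v = "\<lambda>s. s ^ 2 * y - ?a2 * s"
  have "regular_at_0 (\<lambda>s. - 2 * y + 2 * ?v s ^ 2 - 2 * ?t * ?v s + z ^ 2 * w + w ^ 2 + ?t * w
      + ?a3 * z - 3 * ?v s * w)"
    by (intro regular_intros)
  then show "regular_at_0 (\<lambda>s. ev (reference_hamiltonian \<alpha>\<^sub>2 \<alpha>\<^sub>3) (1 / s) (?v s) z w)"
  proof (rule regular_at_0_cong)
    fix s :: ct assume s: "s \<noteq> 0"
    have "- 2 * (1 / s) ^ 2 * ?v s - 2 * ?a2 * (1 / s) = - 2 * y"
      using s by (simp add: field_simps power2_eq_square)
    then show "- 2 * y + 2 * ?v s ^ 2 - 2 * ?t * ?v s + z ^ 2 * w + w ^ 2 + ?t * w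
      + ?a3 * z - 3 * ?v s * w = ev (reference_hamiltonian \<alpha>\<^sub>2 \<alpha>\<^sub>3) (1 / s) (?v s) z w"
      unfolding ev_reference_hamiltonian by algebra
  qed
qed

lemma reference_hamiltonian_chart2: "polynomial_in_chart2 (to_fract [:\<alpha>\<^sub>3:]) (reference_hamiltonian \<alpha>\<^sub>2 \<alpha>\<^sub>3)"
  unfolding polynomial_in_chart2_def
proof (intro allI)
  fix x y w
  let ?t = "to_fract [:0, 1:]" and ?a2 = "to_fract [:\<alpha>\<^sub>2:]" and ?a3 = "to_fract [:\<alpha>\<^sub>3:]"
  let ?v = "\<lambda>s. s ^ 2 * w - ?a3 * s"
  have "regular_at_0 (\<lambda>s. - 2 * x ^ 2 * y + 2 * y ^ 2 - 2 * ?t * y - 2 * ?a2 * x + w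
      + ?v s ^ 2 + ?t * ?v s - 3 * y * ?v s)"
    by (intro regular_intros)
  then show "regular_at_0 (\<lambda>s. ev (reference_hamiltonian \<alpha>\<^sub>2 \<alpha>\<^sub>3) x y (1 / s) (?v s))"
  proof (rule regular_at_0_cong)
    fix s :: ct assume s: "s \<noteq> 0"
    define r where "r = 1 / s"
    have rs: "s * r = 1" using s by (simp add: r_def)
    show "- 2 * x ^ 2 * y + 2 * y ^ 2 - 2 * ?t * y - 2 * ?a2 * x + w
      + ?v s ^ 2 + ?t * ?v s - 3 * y * ?v s = ev (reference_hamiltonian \<alpha>\<^sub>2 \<alpha>\<^sub>3) x y (1 / s) (?v s)"
      unfolding ev_reference_hamiltonian r_def[symmetric] using rs by algebra
  qed
qed

text \<open>
  The coefficient of \<open>1 / s\<close> is \<open>1 - 2 \<alpha>\<^sub>1 - 2 \<alpha>\<^sub>2 - \<alpha>\<^sub>3\<close>.  This is where the relation between the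
  parameters enters, and it fits the correction \<open>x\<close> with coefficient exactly 1.
\<close>

lemma reference_hamiltonian_chart3:
  assumes "2 * \<alpha>\<^sub>1 + 2 * \<alpha>\<^sub>2 + \<alpha>\<^sub>3 = 1"
  shows "polynomial_in_chart3 (to_fract [:\<alpha>\<^sub>1:]) (to_fract [:0, 1:]) 1 (reference_hamiltonian \<alpha>\<^sub>2 \<alpha>\<^sub>3)"
  unfolding polynomial_in_chart3_def
proof (intro allI)
  fix y p q
  let ?t = "to_fract [:0, 1:]"
  let ?a1 = "to_fract [:\<alpha>\<^sub>1:]" and ?a2 = "to_fract [:\<alpha>\<^sub>2:]" and ?a3 = "to_fract [:\<alpha>\<^sub>3:]"
  have "[:\<alpha>\<^sub>1:] + [:\<alpha>\<^sub>1:] + ([:\<alpha>\<^sub>2:] + [:\<alpha>\<^sub>2:]) + [:\<alpha>\<^sub>3:] = 1"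
    using assms by (simp add: one_pCons)
  then have "to_fract ([:\<alpha>\<^sub>1:] + [:\<alpha>\<^sub>1:] + ([:\<alpha>\<^sub>2:] + [:\<alpha>\<^sub>2:]) + [:\<alpha>\<^sub>3:]) = 1"
    by (simp only: to_fract_1)
  then have rel: "2 * ?a1 + 2 * ?a2 + ?a3 = 1" by (simp only: to_fract_add mult_2)
  let ?n = "p * q + ?a1"
  let ?m = "\<lambda>s. ?t - s * ?n + s ^ 2 * y"
  have "regular_at_0 (\<lambda>s. 2 * y - 2 * p * ?n + 2 * p * s * y + 2 * ?m s * (- s * ?n + s ^ 2 * y)
      + s * q ^ 2 * p - ?a3 * s * q + p * (?n - s * y))"
    by (intro regular_intros)
  then show "regular_at_0 (\<lambda>s. ev (reference_hamiltonian \<alpha>\<^sub>2 \<alpha>\<^sub>3) (1 / s)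
      (1 / s ^ 2 + p / s + ?t - s * (p * q + ?a1) + s ^ 2 * y) (- (1 / s) - s * q) (p / s) + 1 / s)"
  proof (rule regular_at_0_cong)
    fix s :: ct assume s: "s \<noteq> 0"
    define r where "r = 1 / s"
    have rs: "s * r = 1" using s by (simp add: r_def)
    have e: "1 / s ^ 2 = r ^ 2" "p / s = p * r" "1 / s = r" by (simp_all add: r_def power_divide)
    show "2 * y - 2 * p * ?n + 2 * p * s * y + 2 * ?m s * (- s * ?n + s ^ 2 * y)
      + s * q ^ 2 * p - ?a3 * s * q + p * (?n - s * y) = ev (reference_hamiltonian \<alpha>\<^sub>2 \<alpha>\<^sub>3) (1 / s)
      (1 / s ^ 2 + p / s + ?t - s * (p * q + ?a1) + s ^ 2 * y) (- (1 / s) - s * q) (p / s) + 1 / s"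
      unfolding ev_reference_hamiltonian e using rs rel by algebra
  qed
qed

text \<open>
  The nested coefficient lists, from which the coefficients can be read off; outermost are the
  powers of \<open>w\<close>, then those of \<open>z\<close>, \<open>y\<close> and \<open>x\<close>.
\<close>

lemma reference_hamiltonian_explicit: "reference_hamiltonian \<alpha>\<^sub>2 \<alpha>\<^sub>3 =
  [: [: [: [:0, - 2 * to_fract [:\<alpha>\<^sub>2:]:], [:- 2 * to_fract [:0, 1:], 0, - 2:], [:2:] :],
        [:[:to_fract [:\<alpha>\<^sub>3:]:]:] :],
     [: [: [:to_fract [:0, 1:]:], [:- 3:] :], 0, 1 :],
     1 :]"
  by (simp add: reference_hamiltonian_def X_def Y_def Z_def W_def T_def const_def scalar_def power2_eq_square
      numeral_poly one_pCons)

lemma reference_hamiltonian_coeffs: "coeff4 (reference_hamiltonian \<alpha>\<^sub>2 \<alpha>\<^sub>3) 0 2 0 0 = 2"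
  "coeff4 (reference_hamiltonian \<alpha>\<^sub>2 \<alpha>\<^sub>3) i j k l \<noteq> 0 \<Longrightarrow> i + j + k + l \<le> 5"
   by (auto simp: coeff4_def reference_hamiltonian_explicit coeff_pCons numeral_2_eq_2 of_bool_def split: nat.splits if_splits)

lemma coeff4_scalar_mult: "coeff4 (P - scalar r * Q) i j k l = coeff4 P i j k l - r * coeff4 Q i j k l"
  by (simp add: coeff4_def scalar_def)

lemma hamiltonian_system_reference_hamiltonian: "hamiltonian_system (reference_hamiltonian \<alpha>\<^sub>2 \<alpha>\<^sub>3) =
      (- 2 * X^2 + 4 * Y - 3 * W - 2 * T,
       4 * X * Y + 2 * const \<alpha>\<^sub>2,
       Z^2 + 2 * W - 3 * Y + T,
       - 2 * Z * W - const \<alpha>\<^sub>3)"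
  by (simp add: hamiltonian_system_def reference_hamiltonian_def pd_generators
     derivation_pd[THEN derivation_rules(1)] derivation_pd[THEN derivation_rules(2)]
  derivation_pd[THEN derivation_rules(3)] derivation_pd[THEN derivation_rules(4)]
  derivation_pd[THEN derivation_rules(5)] derivation_pd[THEN derivation_rules(6)]
  derivation_pd[THEN derivation_rules(7)] derivation_pd[THEN derivation_rules(8)] algebra_simps)

theorem theorem3p1:
  fixes \<alpha>\<^sub>1 \<alpha>\<^sub>2 \<alpha>\<^sub>3 :: complex and H :: ct_xyzw
  assumes "2 * \<alpha>\<^sub>1 + 2 * \<alpha>\<^sub>2 + \<alpha>\<^sub>3 = 1"
    and "total_degree_le H 5"
    and "becomes_polynomial_hamiltonian (hamiltonian_system H) (coords1 \<alpha>\<^sub>2)"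
    and "becomes_polynomial_hamiltonian (hamiltonian_system H) (coords2 \<alpha>\<^sub>3)"
    and "becomes_polynomial_hamiltonian (hamiltonian_system H) (coords3 \<alpha>\<^sub>1)"
  shows "hamiltonian_system H =
      (- 2 * X^2 + 4 * Y - 3 * W - 2 * T,
       4 * X * Y + 2 * const \<alpha>\<^sub>2,
       Z^2 + 2 * W - 3 * Y + T,
       - 2 * Z * W - const \<alpha>\<^sub>3)
    \<and> hamiltonian_system H = hamiltonian_system
      (- 2 * X^2 * Y + 2 * Y^2 - 2 * T * Y - 2 * const \<alpha>\<^sub>2 * X
       + Z^2 * W + W^2 + T * W + const \<alpha>\<^sub>3 * Z - 3 * Y * W)"
proof -
  let ?K = "reference_hamiltonian \<alpha>\<^sub>2 \<alpha>\<^sub>3" and ?t = "to_fract [:0, 1:]"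
  let ?a1 = "to_fract [:\<alpha>\<^sub>1:]" and ?a2 = "to_fract [:\<alpha>\<^sub>2:]" and ?a3 = "to_fract [:\<alpha>\<^sub>3:]"
  have H1: "polynomial_in_chart1 ?a2 H"
    using chart1_hamiltonian[OF assms(3)] polynomial_in_chart1_of_subst by blast
  have H2: "polynomial_in_chart2 ?a3 H"
    using chart2_hamiltonian[OF assms(4)] polynomial_in_chart2_of_subst by blast
  have H3: "polynomial_in_chart3 ?a1 ?t 1 H"
    using chart3_hamiltonian[OF assms(5)] polynomial_in_chart3_of_subst by blast
  \<comment> \<open>Subtracting this multiple removes \<open>y\<^sup>2\<close>, the one coefficient that rigidity does not control.\<close>
  define r where "r = coeff4 H 0 2 0 0 / 2"
  define D where "D = H - scalar r * ?K"
  have ev_D: "ev D x y z w = ev H x y z w - r * ev ?K x y z w" for x y z w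
    by (simp add: D_def ev_simps ev_scalar)
  have deg: "i + j + k + l \<le> 5" if "coeff4 D i j k l \<noteq> 0" for i j k l
  proof (rule ccontr)
    assume "\<not> i + j + k + l \<le> 5"
    then have "coeff4 H i j k l = 0" "coeff4 ?K i j k l = 0"
      using assms(2) reference_hamiltonian_coeffs(2) unfolding total_degree_le_def coeff4_def[of H] by blast+
    then show False using that by (simp add: D_def coeff4_scalar_mult)
  qed
  have D1: "polynomial_in_chart1 ?a2 D"
    using H1 reference_hamiltonian_chart1[of \<alpha>\<^sub>2 \<alpha>\<^sub>3] unfolding polynomial_in_chart1_def ev_D
    by (auto intro!: regular_intros)
  have D2: "polynomial_in_chart2 ?a3 D"
    using H2 reference_hamiltonian_chart2[of \<alpha>\<^sub>3 \<alpha>\<^sub>2] unfolding polynomial_in_chart2_def ev_D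
    by (auto intro!: regular_intros)
  have D3: "polynomial_in_chart3 ?a1 ?t (1 - r) D"
    unfolding polynomial_in_chart3_def
  proof (intro allI)
    fix y p q
    let ?at = "\<lambda>P s. ev P (1 / s) (1 / s ^ 2 + p / s + ?t - s * (p * q + ?a1) + s ^ 2 * y)
        (- (1 / s) - s * q) (p / s)"
    have "regular_at_0 (\<lambda>s. (?at H s + 1 / s) - r * (?at ?K s + 1 / s))"
      using H3 reference_hamiltonian_chart3[OF assms(1)] unfolding polynomial_in_chart3_def
      by (intro regular_at_0_diff regular_at_0_mult regular_at_0_const) auto
    then show "regular_at_0 (\<lambda>s. ?at D s + (1 - r) / s)"
      by (rule regular_at_0_cong) (simp add: ev_D algebra_simps diff_divide_distrib)
  qed
  have yy: "coeff4 D 0 2 0 0 = 0"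
    by (simp add: D_def coeff4_scalar_mult reference_hamiltonian_coeffs r_def)
  note rigid = rigidity[OF deg D1 D2 D3 yy]
  \<comment> \<open>The corrections of \<open>H\<close> and of the reference Hamiltonian are both \<open>x\<close>, so \<open>D\<close> has correction \<open>(1 - r) x\<close>.\<close>
  have "r = 1" using rigid(1) by simp
  have "D = scalar (coeff4 D 0 0 0 0)"
    by (rule coeff4_eqI) (use rigid(2) in \<open>auto simp: coeff4_scalar\<close>)
  moreover have "scalar 1 = 1" by (simp add: scalar_def one_pCons)
  ultimately have H: "H = ?K + scalar (coeff4 D 0 0 0 0)"
    by (simp add: D_def \<open>r = 1\<close> algebra_simps)
  have "hamiltonian_system H = hamiltonian_system ?K"
    by (subst H) (simp add: hamiltonian_system_def pd_add pd_scalar)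
  then show ?thesis
    using hamiltonian_system_reference_hamiltonian[of \<alpha>\<^sub>2 \<alpha>\<^sub>3] by (simp add: reference_hamiltonian_def)
qed

end
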